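(* Let $P,Q\in\mathbb Z$, $Q\ne0$, $f(t)=t^2-Pt+Q$, $D=P^2-4Q\ne0$, and let $p$ be a prime with $p\nmid Q$. Let $G^*(f)$ be Laxton's group with subgroups $G^*(f,p)_L,K^*(f,p)_L,H^*(f,p)_L$, and let $G^*_{\mathbb Q}(f)$ with subgroups $G^*(f,p),K^*(f,p),H^*(f,p)$ be as in the context. Under the natural group isomorphism $\iota:G^*(f)\to G^*_{\mathbb Q}(f)$, $\mathcal W\mapsto\mathcal W$, we have $\iota(G^*(f,p)_L)=G^*(f,p)$, $\iota(K^*(f,p)_L)=K^*(f,p)$ and $\iota(H^*(f,p)_L)=H^*(f,p)$. Moreover there is an exact sequence of groups $$1\to G^*(f,p)\to K^*(f,p)\xrightarrow{\mathrm{red}_p}G^*_{\mathbb F_p}(f)\to1,$$ where $\mathrm{red}_p[w_1:w_0]=[w_1\bmod p:w_0\bmod p]$ for a representative with $w_0,w_1\in\mathbb Z$ coprime.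
   Context: For an integral domain $R$ with $Q\in R^\times$: $\mathscr S(f,R)^{\times}$ is the set of sequences $(w_n)_{n\in\mathbb Z}$ in $R$ with $w_{n+2}-Pw_{n+1}+Qw_n=0$ and $\Lambda(w_1,w_0):=w_1^2-Pw_0w_1+Qw_0^2\in R^{\times}$, a group under $(w_n)*(v_n)=(u_n)$, $u_1=w_1v_1-Qw_0v_0$, $u_0=w_0v_1+w_1v_0-Pw_0v_0$. $G_R(f)$ is its quotient by ${\bf w}\sim{\bf v}\iff w_n=\lambda v_n\ \forall n$ ($\lambda\in R^\times$), and $G^*_R(f)$ its quotient by ${\bf w}\sim^*{\bf v}\iff w_n=\lambda v_{n+\nu}\ \forall n$ ($\lambda\in R^\times,\nu\in\mathbb Z$); $[w_1:w_0]$ denotes the class of the sequence with initial terms $w_1,w_0$; $\pi:G_{\mathbb Q}(f)\to G^*_{\mathbb Q}(f)$ is the natural surjection. Laxton's group $G^*(f)$: the set of rational sequences $(w_n)$ satisfying the recurrence, with $\Lambda(w_1,w_0)\ne0$ and $w_k\in\mathbb Z$ for all $k\ge\nu$ for some $\nu$, modulo $\sim^*$ over $\mathbb Q$, with the same product. Say $p\mid{\bf w}$ if $w_n\in p\mathbb Z_{(p)}$ for some $n$. $G^*(f,p)_L=\{\mathcal W: p\mid{\bf w}\text{ for all }{\bf w}\in\mathcal W\}$; $K^*(f,p)_L=\{\mathcal W:\exists {\bf w}\in\mathcal W$ with $w_0,w_1\in\mathbb Z$, $p\nmid\Lambda(w_1,w_0)\}$; $H^*(f,p)_L=\{\mathcal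 W:\mathcal W^n\in G^*(f,p)_L$ for some nonzero $n\in\mathbb Z\}$. The reduction $\mathrm{red}_p:G_{\mathbb Q}(f)\to\mathbb P^1(\mathbb F_p)$ sends $[w_1:w_0]$, with $w_0,w_1\in\mathbb Z$ coprime, to $[w_1:w_0]\bmod p$; $G_{\mathbb F_p}(f)\subset\mathbb P^1(\mathbb F_p)$. Define $G(f,p)=\{x\in G_{\mathbb Q}(f):\mathrm{red}_p(x)=[1:0]\}$, $K(f,p)=\{x:\mathrm{red}_p(x)\in G_{\mathbb F_p}(f)\}$, $H(f,p)=\{x:\mathrm{red}_p(x^n)=[1:0]\text{ for some nonzero } n\in\mathbb Z\}$, and $G^*(f,p)=\pi(G(f,p))$, $K^*(f,p)=\pi(K(f,p))$, $H^*(f,p)=\pi(H(f,p))$. *)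

theory Defs
  imports "HOL-Algebra.Algebraic_Closure_Type" "HOL-Number_Theory.Residues"
begin

text \<open>
  Throughout, \<open>P\<close> and \<open>Q\<close> are elements of the domain \<open>R\<close>, \<open>Q\<close> a unit.
  For \<open>R = \<rat>\<close> and \<open>R = \<bbbF>\<^sub>p\<close> they are the images of two integers.
\<close>

definition rec_seqs :: "('a, 'b) ring_scheme \<Rightarrow> 'a \<Rightarrow> 'a \<Rightarrow> (int \<Rightarrow> 'a) set" where
  "rec_seqs R P Q = {w. (\<forall>n. w n \<in> carrier R) \<and>
     (\<forall>n. (w (n + 2) \<ominus>\<^bsub>R\<^esub> P \<otimes>\<^bsub>R\<^esub> w (n + 1)) \<oplus>\<^bsub>R\<^esub> Q \<otimes>\<^bsub>R\<^esub> w n = \<zero>\<^bsub>R\<^esub>)}"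

definition Lam :: "('a, 'b) ring_scheme \<Rightarrow> 'a \<Rightarrow> 'a \<Rightarrow> 'a \<Rightarrow> 'a \<Rightarrow> 'a" where
  "Lam R P Q w1 w0 =
     (w1 [^]\<^bsub>R\<^esub> (2::nat) \<ominus>\<^bsub>R\<^esub> P \<otimes>\<^bsub>R\<^esub> w0 \<otimes>\<^bsub>R\<^esub> w1) \<oplus>\<^bsub>R\<^esub> Q \<otimes>\<^bsub>R\<^esub> w0 [^]\<^bsub>R\<^esub> (2::nat)"

text \<open>As \<open>Q\<close> is a unit, a solution on all of \<open>\<int>\<close> is determined by its terms at 1 and 0.\<close>

definition init_seq :: "('a, 'b) ring_scheme \<Rightarrow> 'a \<Rightarrow> 'a \<Rightarrow> 'a \<Rightarrow> 'a \<Rightarrow> (int \<Rightarrow> 'a)" where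
  "init_seq R P Q w1 w0 = (THE w. w \<in> rec_seqs R P Q \<and> w 1 = w1 \<and> w 0 = w0)"

text \<open>The unit is the Lucas sequence, with initial terms \<open>w\<^sub>1 = 1\<close>, \<open>w\<^sub>0 = 0\<close>.\<close>

definition seq_group :: "('a, 'b) ring_scheme \<Rightarrow> 'a \<Rightarrow> 'a \<Rightarrow> (int \<Rightarrow> 'a) monoid" where
  "seq_group R P Q =
     \<lparr>carrier = {w \<in> rec_seqs R P Q. Lam R P Q (w 1) (w 0) \<in> Units R},
      monoid.mult = (\<lambda>w v. init_seq R P Q
        (w 1 \<otimes>\<^bsub>R\<^esub> v 1 \<ominus>\<^bsub>R\<^esub> Q \<otimes>\<^bsub>R\<^esub> w 0 \<otimes>\<^bsub>R\<^esub> v 0)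
        ((w 0 \<otimes>\<^bsub>R\<^esub> v 1 \<oplus>\<^bsub>R\<^esub> w 1 \<otimes>\<^bsub>R\<^esub> v 0) \<ominus>\<^bsub>R\<^esub> P \<otimes>\<^bsub>R\<^esub> w 0 \<otimes>\<^bsub>R\<^esub> v 0)),
      one = init_seq R P Q \<one>\<^bsub>R\<^esub> \<zero>\<^bsub>R\<^esub>\<rparr>"

definition scale_rel :: "('a, 'b) ring_scheme \<Rightarrow> (int \<Rightarrow> 'a) set \<Rightarrow> ((int \<Rightarrow> 'a) \<times> (int \<Rightarrow> 'a)) set" where
  "scale_rel R S = {(w, v). w \<in> S \<and> v \<in> S \<and>
     (\<exists>c \<in> Units R. \<forall>n. w n = c \<otimes>\<^bsub>R\<^esub> v n)}"

definition shift_rel :: "('a, 'b) ring_scheme \<Rightarrow> (int \<Rightarrow> 'a) set \<Rightarrow> ((int \<Rightarrow> 'a) \<times> (int \<Rightarrow> 'a)) set" where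
  "shift_rel R S = {(w, v). w \<in> S \<and> v \<in> S \<and>
     (\<exists>c \<in> Units R. \<exists>m::int. \<forall>n. w n = c \<otimes>\<^bsub>R\<^esub> v (n + m))}"

text \<open>Quotient of a monoid by a congruence; the product of two classes is the class of the
  products of their elements.\<close>

definition quot_monoid :: "('a, 'b) monoid_scheme \<Rightarrow> ('a \<times> 'a) set \<Rightarrow> 'a set monoid" where
  "quot_monoid M r =
     \<lparr>carrier = carrier M // r,
      monoid.mult = (\<lambda>A B. \<Union>a\<in>A. \<Union>b\<in>B. r `` {a \<otimes>\<^bsub>M\<^esub> b}),
      one = r `` {\<one>\<^bsub>M\<^esub>}\<rparr>"

definition G_grp :: "('a, 'b) ring_scheme \<Rightarrow> 'a \<Rightarrow> 'a \<Rightarrow> (int \<Rightarrow> 'a) set monoid" where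
  "G_grp R P Q = quot_monoid (seq_group R P Q) (scale_rel R (carrier (seq_group R P Q)))"

definition Gs_grp :: "('a, 'b) ring_scheme \<Rightarrow> 'a \<Rightarrow> 'a \<Rightarrow> (int \<Rightarrow> 'a) set monoid" where
  "Gs_grp R P Q = quot_monoid (seq_group R P Q) (shift_rel R (carrier (seq_group R P Q)))"

text \<open>The \<open>\<sim>\<^sup>*\<close>-class \<open>[w\<^sub>1 : w\<^sub>0]\<close>.\<close>

definition Gs_class :: "('a, 'b) ring_scheme \<Rightarrow> 'a \<Rightarrow> 'a \<Rightarrow> 'a \<Rightarrow> 'a \<Rightarrow> (int \<Rightarrow> 'a) set" where
  "Gs_class R P Q w1 w0 =
     shift_rel R (carrier (seq_group R P Q)) `` {init_seq R P Q w1 w0}"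

abbreviation rat_ring :: "rat ring" where
  "rat_ring \<equiv> ring_of_type_algebra"

abbreviation GQ :: "int \<Rightarrow> int \<Rightarrow> (int \<Rightarrow> rat) set monoid" where
  "GQ P Q \<equiv> G_grp rat_ring (of_int P) (of_int Q)"

abbreviation GsQ :: "int \<Rightarrow> int \<Rightarrow> (int \<Rightarrow> rat) set monoid" where
  "GsQ P Q \<equiv> Gs_grp rat_ring (of_int P) (of_int Q)"

abbreviation GF :: "int \<Rightarrow> int \<Rightarrow> nat \<Rightarrow> (int \<Rightarrow> int) set monoid" where
  "GF P Q p \<equiv> G_grp (residue_ring (int p)) (P mod int p) (Q mod int p)"

abbreviation GsF :: "int \<Rightarrow> int \<Rightarrow> nat \<Rightarrow> (int \<Rightarrow> int) set monoid" where
  "GsF P Q p \<equiv> Gs_grp (residue_ring (int p)) (P mod int p) (Q mod int p)"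

text \<open>A \<open>\<sim>\<close>-class, or a \<open>\<sim>\<^sup>*\<close>-class inside a smaller set of sequences, is sent to the
  \<open>\<sim>\<^sup>*\<close>-class over \<open>\<rat>\<close> that contains it. On \<open>GQ\<close> this is \<open>\<pi>\<close>, on Laxton's group it is \<open>\<iota>\<close>.\<close>

definition to_GsQ :: "int \<Rightarrow> int \<Rightarrow> (int \<Rightarrow> rat) set \<Rightarrow> (int \<Rightarrow> rat) set" where
  "to_GsQ P Q W =
     shift_rel rat_ring (carrier (seq_group rat_ring (of_int P) (of_int Q))) `` W"


subsection \<open>Laxton's group\<close>

definition laxton_seqs :: "int \<Rightarrow> int \<Rightarrow> (int \<Rightarrow> rat) set" where
  "laxton_seqs P Q = {w \<in> rec_seqs rat_ring (of_int P) (of_int Q).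
     Lam rat_ring (of_int P) (of_int Q) (w 1) (w 0) \<noteq> 0 \<and> (\<exists>m. \<forall>k\<ge>m. w k \<in> \<int>)}"

text \<open>The classes consist of eventually integral sequences only. This matters for
  \<open>laxton_G\<close>, which quantifies over all members of a class.\<close>

definition laxton_group :: "int \<Rightarrow> int \<Rightarrow> (int \<Rightarrow> rat) set monoid" where
  "laxton_group P Q =
     quot_monoid ((seq_group rat_ring (of_int P) (of_int Q))\<lparr>carrier := laxton_seqs P Q\<rparr>)
       (shift_rel rat_ring (laxton_seqs P Q))"

text \<open>The ideal \<open>p\<int>\<^sub>(\<^sub>p\<^sub>)\<close>, as a subset of \<open>\<rat>\<close>.\<close>

definition p_local_ideal :: "nat \<Rightarrow> rat set" where
  "p_local_ideal p = {of_int (int p * a) / of_int b | a b. \<not> int p dvd b}"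

definition seq_dvd :: "nat \<Rightarrow> (int \<Rightarrow> rat) \<Rightarrow> bool" where
  "seq_dvd p w \<longleftrightarrow> (\<exists>n. w n \<in> p_local_ideal p)"

definition laxton_G :: "int \<Rightarrow> int \<Rightarrow> nat \<Rightarrow> (int \<Rightarrow> rat) set set" where
  "laxton_G P Q p = {W \<in> carrier (laxton_group P Q). \<forall>w\<in>W. seq_dvd p w}"

definition laxton_K :: "int \<Rightarrow> int \<Rightarrow> nat \<Rightarrow> (int \<Rightarrow> rat) set set" where
  "laxton_K P Q p = {W \<in> carrier (laxton_group P Q).
     \<exists>w\<in>W. \<exists>a b::int. w 1 = of_int a \<and> w 0 = of_int b \<and>
       \<not> int p dvd (a^2 - P * b * a + Q * b^2)}"

definition laxton_H :: "int \<Rightarrow> int \<Rightarrow> nat \<Rightarrow> (int \<Rightarrow> rat) set set" where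
  "laxton_H P Q p = {W \<in> carrier (laxton_group P Q).
     \<exists>n::int. n \<noteq> 0 \<and> W [^]\<^bsub>laxton_group P Q\<^esub> n \<in> laxton_G P Q p}"


subsection \<open>Reduction modulo p\<close>

text \<open>The point \<open>[x : y]\<close> of the projective line over a field, as a class of pairs.\<close>

definition proj_pt :: "('a, 'b) ring_scheme \<Rightarrow> 'a \<Rightarrow> 'a \<Rightarrow> ('a \<times> 'a) set" where
  "proj_pt F x y = {(c \<otimes>\<^bsub>F\<^esub> x, c \<otimes>\<^bsub>F\<^esub> y) | c. c \<in> Units F}"

text \<open>The inclusion of \<open>G\<^sub>F(f)\<close> into the projective line.\<close>

definition to_proj :: "(int \<Rightarrow> 'a) set \<Rightarrow> ('a \<times> 'a) set" where
  "to_proj A = (\<lambda>w. (w 1, w 0)) ` A"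

definition coprime_init :: "(int \<Rightarrow> rat) \<Rightarrow> int \<Rightarrow> int \<Rightarrow> bool" where
  "coprime_init w a b \<longleftrightarrow> w 1 = of_int a \<and> w 0 = of_int b \<and> coprime a b"

definition red_proj :: "nat \<Rightarrow> (int \<Rightarrow> rat) set \<Rightarrow> (int \<times> int) set" where
  "red_proj p A = (THE c. \<exists>w\<in>A. \<exists>a b. coprime_init w a b \<and>
     c = proj_pt (residue_ring (int p)) (a mod int p) (b mod int p))"

definition G_p :: "int \<Rightarrow> int \<Rightarrow> nat \<Rightarrow> (int \<Rightarrow> rat) set set" where
  "G_p P Q p = {A \<in> carrier (GQ P Q). red_proj p A = proj_pt (residue_ring (int p)) 1 0}"

definition K_p :: "int \<Rightarrow> int \<Rightarrow> nat \<Rightarrow> (int \<Rightarrow> rat) set set" where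
  "K_p P Q p = {A \<in> carrier (GQ P Q). red_proj p A \<in> to_proj ` carrier (GF P Q p)}"

definition H_p :: "int \<Rightarrow> int \<Rightarrow> nat \<Rightarrow> (int \<Rightarrow> rat) set set" where
  "H_p P Q p = {A \<in> carrier (GQ P Q). \<exists>n::int. n \<noteq> 0 \<and>
     red_proj p (A [^]\<^bsub>GQ P Q\<^esub> n) = proj_pt (residue_ring (int p)) 1 0}"

definition Gs_p :: "int \<Rightarrow> int \<Rightarrow> nat \<Rightarrow> (int \<Rightarrow> rat) set set" where
  "Gs_p P Q p = to_GsQ P Q ` G_p P Q p"

definition Ks_p :: "int \<Rightarrow> int \<Rightarrow> nat \<Rightarrow> (int \<Rightarrow> rat) set set" where
  "Ks_p P Q p = to_GsQ P Q ` K_p P Q p"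

definition Hs_p :: "int \<Rightarrow> int \<Rightarrow> nat \<Rightarrow> (int \<Rightarrow> rat) set set" where
  "Hs_p P Q p = to_GsQ P Q ` H_p P Q p"

definition red_Gs :: "int \<Rightarrow> int \<Rightarrow> nat \<Rightarrow> (int \<Rightarrow> rat) set \<Rightarrow> (int \<Rightarrow> int) set" where
  "red_Gs P Q p W = (THE c. \<exists>w\<in>W. \<exists>a b. coprime_init w a b \<and>
     c = Gs_class (residue_ring (int p)) (P mod int p) (Q mod int p) (a mod int p) (b mod int p))"

text \<open>The library's \<open>exact_seq\<close> requires all groups to have the same element type.\<close>

definition short_exact ::
  "('a, 'd) monoid_scheme \<Rightarrow> ('a \<Rightarrow> 'b) \<Rightarrow> ('b, 'e) monoid_scheme \<Rightarrow> ('b \<Rightarrow> 'c) \<Rightarrow>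
   ('c, 'f) monoid_scheme \<Rightarrow> bool" where
  "short_exact A i B h C \<longleftrightarrow> group_hom A B i \<and> group_hom B C h \<and>
     inj_on i (carrier A) \<and> i ` carrier A = kernel B C h \<and> h ` carrier B = carrier C"

end

theory Submission
  imports Defs
begin

text \<open>
  Let \<open>\<theta>, \<theta>'\<close> be the roots of \<open>f\<close>. Attaching \<open>w\<^sub>1 - w\<^sub>0 \<theta>'\<close> to a sequence \<open>w\<close> turns the product
  of sequences into multiplication in \<open>R[\<theta>]\<close>, \<open>\<Lambda>\<close> into the norm and the shift into multiplication by
  \<open>\<theta>\<close>; hence both equivalence relations are congruences. Since \<open>p\<close> does not divide \<open>Q\<close>, a solution
  whose terms at 0 and 1 lie in \<open>\<int>\<^sub>(\<^sub>p\<^sub>)\<close> lies in \<open>\<int>\<^sub>(\<^sub>p\<^sub>)\<close> everywhere, and if two consecutive terms are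
  divisible by \<open>p\<close> then so are all terms. So two sequences that are primitive at \<open>p\<close> and equivalent
  over \<open>\<rat>\<close> differ by a shift and a unit of \<open>\<int>\<^sub>(\<^sub>p\<^sub>)\<close>, and have equivalent reductions modulo \<open>p\<close>. All
  groups of the theorem are therefore images of the group \<open>\<S>(f, \<int>\<^sub>(\<^sub>p\<^sub>))\<^sup>\<times>\<close>, of its subgroup given by
  \<open>p | w\<^sub>0\<close>, and of the elements some power of which lies in that subgroup up to scaling. The
  reductions of the shifts of the Lucas sequence lie in a finite group; this is why taking
  roots of elements commutes with \<open>\<pi>\<close>.
\<close>

section \<open>The group of sequences over a commutative ring\<close>

text \<open>Laxton's divisibility condition ranges over every eventually integral member of a class,
  whereas reduction works with one well-chosen member. Primitivity at p reconciles the two. Every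
  class has a member with coprime integers at 1 and 0, and a relation
  \<open>w n = c * v (n + m)\<close> with v primitive forces c into Z_(p) as soon as w is p-integral
  from some index on. Inverses are the second obstacle: they divide by \<Lambda>, so they may leave
  Laxton's set of sequences. His quotient is shown to be a group only by transport along the
  bijection with \<open>GsQ P Q\<close>. The third concerns H. A root of an image under a
  homomorphism is a priori a root only up to an element of the kernel, so the kernel must itself
  consist of roots; \<open>radical_image\<close> isolates this condition. The algebra of the
  recurrence is done once over a commutative ring in which Q is a unit and then used both over the
  rationals and over the residue field.\<close>

lemma bij_betw_int_orbit:
  assumes T: "bij_betw T A A" and x: "x \<in> A"
  obtains f :: "int \<Rightarrow> 'a" where "f 0 = x" "\<And>n. f n \<in> A" "\<And>n. f (n + 1) = T (f n)"
proof
  let ?S = "inv_into A T"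
  let ?f = "\<lambda>n::int. if n \<ge> 0 then (T ^^ nat n) x else (?S ^^ nat (- n)) x"
  have TA: "T y \<in> A" "?S y \<in> A" "T (?S y) = y" if "y \<in> A" for y
    using that T by (auto simp: bij_betw_def f_inv_into_f inv_into_into)
  have pos: "(T ^^ k) x \<in> A" and neg: "(?S ^^ k) x \<in> A" for k
    by (induction k) (use x TA in auto)
  show "?f 0 = x" "?f n \<in> A" for n
    using pos neg by auto
  show "?f (n + 1) = T (?f n)" for n
  proof (cases "n \<ge> 0")
    case True
    then show ?thesis by (simp add: nat_add_distrib)
  next
    case False
    define k where "k = nat (- n - 1)"
    from False have n: "n = - int k - 1" "nat (- n) = Suc k"
      by (auto simp: k_def)
    then have "T (?f n) = (?S ^^ k) x"
      using TA(3)[OF neg[of k]] by simp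
    also have "\<dots> = ?f (n + 1)"
      by (cases k) (simp_all add: n nat_add_distrib add.commute)
    finally show ?thesis by simp
  qed
qed

lemma int_pair_induct [case_names zero one up down]:
  fixes A :: "int \<Rightarrow> bool"
  assumes "A 0" "A 1"
    and "\<And>n. A n \<Longrightarrow> A (n + 1) \<Longrightarrow> A (n + 2)"
    and "\<And>n. A (n + 1) \<Longrightarrow> A (n + 2) \<Longrightarrow> A n"
  shows "A n"
proof -
  have "A n \<and> A (n + 1)"
  proof (induction n rule: int_induct[where k = 0])
    case base
    then show ?case using assms by simp
  next
    case (step1 i)
    then show ?case using assms(3)[of i] by (simp add: add.assoc)
  next
    case (step2 i)
    then show ?case using assms(4)[of "i - 1"] by (simp add: algebra_simps)
  qed
  then show ?thesis ..
qed

text \<open>The product of two classes is a union over all pairs of members. The congruence makes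
  all terms of this union the same class, and a and b themselves keep it nonempty.\<close>

lemma quot_monoid_mult:
  assumes r: "equiv (carrier M) r"
    and cong: "\<And>a a' b b'. (a, a') \<in> r \<Longrightarrow> (b, b') \<in> r \<Longrightarrow> (a \<otimes>\<^bsub>M\<^esub> b, a' \<otimes>\<^bsub>M\<^esub> b') \<in> r"
    and "a \<in> carrier M" "b \<in> carrier M"
  shows "r `` {a} \<otimes>\<^bsub>quot_monoid M r\<^esub> r `` {b} = r `` {a \<otimes>\<^bsub>M\<^esub> b}"
proof -
  have "r `` {a' \<otimes>\<^bsub>M\<^esub> b'} = r `` {a \<otimes>\<^bsub>M\<^esub> b}" if "a' \<in> r `` {a}" "b' \<in> r `` {b}" for a' b'
  proof -
    from that have "(a, a') \<in> r" "(b, b') \<in> r"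
      by simp_all
    then have "(a \<otimes>\<^bsub>M\<^esub> b, a' \<otimes>\<^bsub>M\<^esub> b') \<in> r"
      by (rule cong)
    then show ?thesis
      by (rule equiv_class_eq[OF r, symmetric])
  qed
  moreover have "a \<in> r `` {a}" "b \<in> r `` {b}"
    using equiv_class_self[OF r] assms(3,4) by blast+
  ultimately have "(\<Union>a'\<in>r `` {a}. \<Union>b'\<in>r `` {b}. r `` {a' \<otimes>\<^bsub>M\<^esub> b'}) = r `` {a \<otimes>\<^bsub>M\<^esub> b}"
    by blast
  then show ?thesis
    by (simp add: quot_monoid_def)
qed

lemma quot_monoid_hom:
  assumes M: "comm_group M" and r: "equiv (carrier M) r"
    and cong: "\<And>a a' b b'. (a, a') \<in> r \<Longrightarrow> (b, b') \<in> r \<Longrightarrow> (a \<otimes>\<^bsub>M\<^esub> b, a' \<otimes>\<^bsub>M\<^esub> b') \<in> r"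
  shows "comm_group (quot_monoid M r)"
    and "group_hom M (quot_monoid M r) (\<lambda>a. r `` {a})"
    and "carrier (quot_monoid M r) = (\<lambda>a. r `` {a}) ` carrier M"
proof -
  let ?q = "\<lambda>a. r `` {a}" and ?K = "quot_monoid M r"
  interpret M: comm_group M by (rule M)
  note mult = quot_monoid_mult[OF r cong]
  show car: "carrier ?K = ?q ` carrier M"
    by (auto simp: quot_monoid_def quotient_def)
  have one: "\<one>\<^bsub>?K\<^esub> = ?q \<one>\<^bsub>M\<^esub>"
    by (simp add: quot_monoid_def)
  have hom: "?q \<in> hom M ?K"
    by (auto simp: hom_def car mult)
  \<comment> \<open>\<open>hom_imp_img_group\<close> produces a group on the image of the
    homomorphism, with the image of the unit; both coincide with what \<open>quot_monoid\<close>
    already has.\<close>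
  have "?K = ?K\<lparr>carrier := ?q ` carrier M, one := ?q \<one>\<^bsub>M\<^esub>\<rparr>"
    using car one by simp
  then have "group ?K"
    using M.hom_imp_img_group[OF hom] by simp
  then interpret K: group ?K .
  show "comm_group ?K"
    by (rule K.group_comm_groupI) (auto simp: car mult M.m_comm)
  show "group_hom M ?K ?q"
    using hom by unfold_locales
qed

context cring
begin

lemma Lam_eq:
  "x \<in> carrier R \<Longrightarrow> y \<in> carrier R \<Longrightarrow>
    Lam R P Q x y = x \<otimes> x \<ominus> P \<otimes> y \<otimes> x \<oplus> Q \<otimes> (y \<otimes> y)"
  by (simp add: Lam_def numeral_2_eq_2)

end

section \<open>Existence and uniqueness of two-sided solutions\<close>

locale recurrence = cring R for R (structure) +
  fixes P Q
  assumes P_closed [simp]: "P \<in> carrier R" and Q_unit [simp]: "Q \<in> Units R"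
begin

abbreviation "RS \<equiv> rec_seqs R P Q"
abbreviation "SG \<equiv> seq_group R P Q"
abbreviation "Nm \<equiv> Lam R P Q"

lemma Q_closed [simp]: "Q \<in> carrier R"
  by (rule Units_closed[OF Q_unit])

lemma rec_seqs_iff:
  "w \<in> RS \<longleftrightarrow> (\<forall>n. w n \<in> carrier R) \<and> (\<forall>n. w (n + 2) = P \<otimes> w (n + 1) \<ominus> Q \<otimes> w n)"
proof -
  have *: "a \<ominus> b \<oplus> c = \<zero> \<longleftrightarrow> a = b \<ominus> c"
    if abc: "a \<in> carrier R" "b \<in> carrier R" "c \<in> carrier R" for a b c
  proof -
    have "a \<ominus> b \<oplus> c = a \<ominus> (b \<ominus> c)"
      using abc by algebra
    then show ?thesis
      using abc by (simp only: r_right_minus_eq minus_closed)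
  qed
  show ?thesis
  proof (cases "\<forall>n. w n \<in> carrier R")
    case True
    then have "w (n + 2) \<ominus> P \<otimes> w (n + 1) \<oplus> Q \<otimes> w n = \<zero> \<longleftrightarrow>
        w (n + 2) = P \<otimes> w (n + 1) \<ominus> Q \<otimes> w n" for n
      by (intro *) simp_all
    then show ?thesis
      by (simp only: rec_seqs_def mem_Collect_eq)
  qed (simp only: rec_seqs_def mem_Collect_eq, blast)
qed

lemma rec_seqsI:
  assumes "\<And>n. w n \<in> carrier R" "\<And>n. w (n + 2) = P \<otimes> w (n + 1) \<ominus> Q \<otimes> w n"
  shows "w \<in> RS"
  using assms by (simp add: rec_seqs_iff)

lemma rec_up: "w \<in> RS \<Longrightarrow> w (n + 2) = P \<otimes> w (n + 1) \<ominus> Q \<otimes> w n"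
  by (simp add: rec_seqs_iff)

lemma rec_closed [simp]: "w \<in> RS \<Longrightarrow> w n \<in> carrier R"
  by (simp add: rec_seqs_iff)

lemma rec_down: "w \<in> RS \<Longrightarrow> Q \<otimes> w n = P \<otimes> w (n + 1) \<ominus> w (n + 2)"
  using rec_closed[of w "n + 1"] rec_closed[of w n] P_closed Q_closed
  by (simp only: rec_up) algebra

lemma Q_cancel: "Q \<otimes> x = Q \<otimes> y \<Longrightarrow> x \<in> carrier R \<Longrightarrow> y \<in> carrier R \<Longrightarrow> x = y"
  using Units_l_cancel[OF Q_unit] by blast

text \<open>Upwards the recurrence determines the terms, downwards the unit Q can be
  cancelled.\<close>

lemma rec_seqs_eqI:
  assumes "w \<in> RS" "v \<in> RS" "w 1 = v 1" "w 0 = v 0"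
  shows "w = v"
proof
  show "w n = v n" for n
  proof (induction n rule: int_pair_induct)
    case zero
    show ?case by (rule assms)
  next
    case one
    show ?case by (rule assms)
  next
    case (up n)
    then show ?case
      by (simp only: rec_up[OF assms(1)] rec_up[OF assms(2)])
  next
    case (down n)
    then have "Q \<otimes> w n = Q \<otimes> v n"
      by (simp only: rec_down[OF assms(1)] rec_down[OF assms(2)])
    then show ?case
      using assms(1,2) by (rule Q_cancel[OF _ rec_closed rec_closed])
  qed
qed

lemma rec_seqs_shift: "w \<in> RS \<Longrightarrow> (\<lambda>n. w (n + m)) \<in> RS"
  using rec_up[of w "n + m" for n] by (intro rec_seqsI) (simp_all add: algebra_simps)

lemma rec_seqs_lincomb:
  assumes "w \<in> RS" "v \<in> RS" "a \<in> carrier R" "b \<in> carrier R"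
  shows "(\<lambda>n. a \<otimes> w n \<oplus> b \<otimes> v n) \<in> RS"
proof -
  have "a \<otimes> w (n + 2) \<oplus> b \<otimes> v (n + 2) =
      P \<otimes> (a \<otimes> w (n + 1) \<oplus> b \<otimes> v (n + 1)) \<ominus> Q \<otimes> (a \<otimes> w n \<oplus> b \<otimes> v n)" for n
    unfolding rec_up[OF assms(1)] rec_up[OF assms(2)]
    using assms(3,4) P_closed Q_closed rec_closed[OF assms(1)] rec_closed[OF assms(2)]
    by algebra
  then show ?thesis
    using assms by (intro rec_seqsI) simp_all
qed

lemma rec_seqs_scale: "w \<in> RS \<Longrightarrow> c \<in> carrier R \<Longrightarrow> (\<lambda>n. c \<otimes> w n) \<in> RS"
  using rec_seqs_lincomb[of w w c \<zero>] by simp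

text \<open>Because Q is invertible, the step from a pair of neighbouring terms to the next is a
  bijection of pairs. Its two-sided orbit carries the sequence in the second component.\<close>

lemma rec_seqs_exist:
  assumes "x \<in> carrier R" "y \<in> carrier R"
  obtains w where "w \<in> RS" "w 1 = x" "w 0 = y"
proof -
  let ?A = "carrier R \<times> carrier R"
  let ?T = "\<lambda>(a, b). (P \<otimes> a \<ominus> Q \<otimes> b, a)"
  let ?S = "\<lambda>(a, b). (b, inv Q \<otimes> (P \<otimes> b \<ominus> a))"
  have QQ: "inv Q \<otimes> (Q \<otimes> z) = z" "Q \<otimes> (inv Q \<otimes> z) = z" if "z \<in> carrier R" for z
    using that by (simp_all add: m_assoc[symmetric])
  have minus: "a \<ominus> (a \<ominus> b) = b" if "a \<in> carrier R" "b \<in> carrier R" for a b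
    using that by algebra
  have "bij_betw ?T ?A ?A"
    by (rule bij_betwI[where g = ?S]) (auto simp: QQ minus)
  then obtain f :: "int \<Rightarrow> 'a \<times> 'a"
    where f: "f 0 = (x, y)" "\<And>n. f n \<in> ?A" "\<And>n. f (n + 1) = ?T (f n)"
    using bij_betw_int_orbit[of ?T ?A "(x, y)"] assms by blast
  have snd: "snd (f (n + 1)) = fst (f n)" for n
    by (simp add: f(3) split: prod.split)
  have fst: "fst (f (n + 1)) = P \<otimes> fst (f n) \<ominus> Q \<otimes> snd (f n)" for n
    by (simp add: f(3) split: prod.split)
  have "snd (f n) \<in> carrier R" for n
    using f(2)[of n] by auto
  moreover have "snd (f (n + 2)) = P \<otimes> snd (f (n + 1)) \<ominus> Q \<otimes> snd (f n)" for n
    using snd[of "n + 1"] fst[of n] snd[of n] by (simp add: add.assoc)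
  ultimately have "(\<lambda>n. snd (f n)) \<in> RS"
    by (intro rec_seqsI) simp_all
  then show ?thesis
    using f(1) snd[of 0] by (intro that[of "\<lambda>n. snd (f n)"]) auto
qed

lemma init_seq_eqI: "w \<in> RS \<Longrightarrow> w 1 = x \<Longrightarrow> w 0 = y \<Longrightarrow> init_seq R P Q x y = w"
  unfolding init_seq_def using rec_seqs_eqI by (intro the_equality) auto

lemma init_seq [simp]:
  assumes "x \<in> carrier R" "y \<in> carrier R"
  shows "init_seq R P Q x y \<in> RS" "init_seq R P Q x y 1 = x" "init_seq R P Q x y 0 = y"
  using rec_seqs_exist[OF assms] init_seq_eqI by metis+

section \<open>The product of sequences\<close>

lemma mult_closed [simp]: "w \<in> RS \<Longrightarrow> v \<in> RS \<Longrightarrow> w \<otimes>\<^bsub>SG\<^esub> v \<in> RS"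
  by (simp add: seq_group_def)

lemma mult_1: "w \<in> RS \<Longrightarrow> v \<in> RS \<Longrightarrow> (w \<otimes>\<^bsub>SG\<^esub> v) 1 = w 1 \<otimes> v 1 \<ominus> Q \<otimes> w 0 \<otimes> v 0"
  by (simp add: seq_group_def)

lemma mult_0: "w \<in> RS \<Longrightarrow> v \<in> RS \<Longrightarrow>
    (w \<otimes>\<^bsub>SG\<^esub> v) 0 = (w 0 \<otimes> v 1 \<oplus> w 1 \<otimes> v 0) \<ominus> P \<otimes> w 0 \<otimes> v 0"
  by (simp add: seq_group_def)

lemma one_rec [simp]: "\<one>\<^bsub>SG\<^esub> \<in> RS" "\<one>\<^bsub>SG\<^esub> 1 = \<one>" "\<one>\<^bsub>SG\<^esub> 0 = \<zero>"
  by (simp_all add: seq_group_def)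

text \<open>In this form the product visibly commutes with shifts of the first factor.\<close>

lemma mult_eq:
  assumes w: "w \<in> RS" and v: "v \<in> RS"
  shows "w \<otimes>\<^bsub>SG\<^esub> v = (\<lambda>n. v 1 \<otimes> w n \<oplus> \<ominus> (Q \<otimes> v 0) \<otimes> w (n + - 1))"
proof (rule rec_seqs_eqI)
  show "w \<otimes>\<^bsub>SG\<^esub> v \<in> RS" using assms by simp
  show "(\<lambda>n. v 1 \<otimes> w n \<oplus> \<ominus> (Q \<otimes> v 0) \<otimes> w (n + - 1)) \<in> RS"
    using w v by (intro rec_seqs_lincomb rec_seqs_shift) auto
  show "(w \<otimes>\<^bsub>SG\<^esub> v) 1 = v 1 \<otimes> w 1 \<oplus> \<ominus> (Q \<otimes> v 0) \<otimes> w (1 + - 1)"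
    unfolding mult_1[OF assms] add.right_inverse
    using rec_closed[OF w] rec_closed[OF v] Q_closed by algebra
  \<comment> \<open>\<open>w (- 1)\<close> occurs only multiplied by Q, so the recurrence evaluates
    it without inverting Q.\<close>
  have "Q \<otimes> w (- 1) = P \<otimes> w 0 \<ominus> w 1"
    using rec_down[OF w, of "- 1"] by simp
  moreover have "\<ominus> (Q \<otimes> v 0) \<otimes> w (- 1) = \<ominus> (Q \<otimes> w (- 1)) \<otimes> v 0"
    using rec_closed[OF w] rec_closed[OF v] Q_closed by algebra
  ultimately show "(w \<otimes>\<^bsub>SG\<^esub> v) 0 = v 1 \<otimes> w 0 \<oplus> \<ominus> (Q \<otimes> v 0) \<otimes> w (0 + - 1)"
    unfolding mult_0[OF assms] add_0 using rec_closed[OF w] rec_closed[OF v] P_closed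
    by (simp only:) algebra
qed

lemma mult_comm: "w \<in> RS \<Longrightarrow> v \<in> RS \<Longrightarrow> w \<otimes>\<^bsub>SG\<^esub> v = v \<otimes>\<^bsub>SG\<^esub> w"
  by (rule rec_seqs_eqI) (simp_all add: mult_1 mult_0 m_ac a_ac)

text \<open>Right multiplication by v is the operator \<open>v 1 - Q * v 0 * S\<close>, where S is
  the backward shift. Such operators are polynomials in S with constant coefficients and therefore
  commute; combined with commutativity of the product this gives associativity.\<close>

lemma mult_right_comm:
  assumes w: "w \<in> RS" and u: "u \<in> RS" and v: "v \<in> RS"
  shows "w \<otimes>\<^bsub>SG\<^esub> u \<otimes>\<^bsub>SG\<^esub> v = w \<otimes>\<^bsub>SG\<^esub> v \<otimes>\<^bsub>SG\<^esub> u"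
proof -
  have "c \<otimes> (a \<otimes> x \<oplus> \<ominus> (Q \<otimes> b) \<otimes> y) \<oplus> \<ominus> (Q \<otimes> d) \<otimes> (a \<otimes> y \<oplus> \<ominus> (Q \<otimes> b) \<otimes> z) =
      a \<otimes> (c \<otimes> x \<oplus> \<ominus> (Q \<otimes> d) \<otimes> y) \<oplus> \<ominus> (Q \<otimes> b) \<otimes> (c \<otimes> y \<oplus> \<ominus> (Q \<otimes> d) \<otimes> z)"
    if "a \<in> carrier R" "b \<in> carrier R" "c \<in> carrier R" "d \<in> carrier R"
      "x \<in> carrier R" "y \<in> carrier R" "z \<in> carrier R" for a b c d x y z
    using that Q_closed by algebra
  note swap = this[OF rec_closed[OF u] rec_closed[OF u] rec_closed[OF v] rec_closed[OF v]
      rec_closed[OF w] rec_closed[OF w] rec_closed[OF w]]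
  show ?thesis
    unfolding mult_eq[OF mult_closed[OF w u] v] mult_eq[OF mult_closed[OF w v] u]
    unfolding mult_eq[OF w u] mult_eq[OF w v] by (rule ext) (rule swap)
qed

lemma mult_assoc:
  assumes "u \<in> RS" "w \<in> RS" "v \<in> RS"
  shows "u \<otimes>\<^bsub>SG\<^esub> w \<otimes>\<^bsub>SG\<^esub> v = u \<otimes>\<^bsub>SG\<^esub> (w \<otimes>\<^bsub>SG\<^esub> v)"
  using mult_right_comm[OF assms(2,1,3)] mult_comm[OF assms(1,2)]
    mult_comm[OF assms(1) mult_closed[OF assms(2,3)]] by (simp only:)

lemma mult_one: "w \<in> RS \<Longrightarrow> \<one>\<^bsub>SG\<^esub> \<otimes>\<^bsub>SG\<^esub> w = w"
  by (rule rec_seqs_eqI) (simp_all add: mult_1 mult_0 a_minus_def)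

lemma mult_scale_shift:
  assumes w: "w \<in> RS" and v: "v \<in> RS" and c: "c \<in> carrier R"
  shows "(\<lambda>n. c \<otimes> w (n + m)) \<otimes>\<^bsub>SG\<^esub> v = (\<lambda>n. c \<otimes> (w \<otimes>\<^bsub>SG\<^esub> v) (n + m))"
proof -
  have "v 1 \<otimes> (c \<otimes> w (n + m)) \<oplus> \<ominus> (Q \<otimes> v 0) \<otimes> (c \<otimes> w (n + - 1 + m)) =
      c \<otimes> (v 1 \<otimes> w (n + m) \<oplus> \<ominus> (Q \<otimes> v 0) \<otimes> w (n + m + - 1))" for n
    using rec_closed[OF w] rec_closed[OF v] c Q_closed
    by (simp only: add.assoc add.commute[of m]) algebra
  then show ?thesis
    unfolding mult_eq[OF rec_seqs_scale[OF rec_seqs_shift[OF w] c] v] mult_eq[OF w v] by (rule ext)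
qed

section \<open>Norm, conjugation and inverses\<close>

lemma Lam_closed [simp]: "x \<in> carrier R \<Longrightarrow> y \<in> carrier R \<Longrightarrow> Nm x y \<in> carrier R"
  by (simp add: Lam_def)

lemma Lam_one: "Nm \<one> \<zero> = \<one>"
  by (simp add: Lam_eq a_minus_def)

text \<open>Conjugation in the quadratic ring: replacing \<theta>' by \<theta> = P - \<theta>' turns
  w1 - w0 \<theta>' into (w1 - P w0) + w0 \<theta>'.\<close>

definition "conj_seq w = init_seq R P Q (w 1 \<ominus> P \<otimes> w 0) (\<ominus> w 0)"

lemma conj_seq [simp]:
  assumes "w \<in> RS"
  shows "conj_seq w \<in> RS" "conj_seq w 1 = w 1 \<ominus> P \<otimes> w 0" "conj_seq w 0 = \<ominus> w 0"
  using assms by (simp_all add: conj_seq_def)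

lemma mult_conj:
  assumes w: "w \<in> RS"
  shows "(w \<otimes>\<^bsub>SG\<^esub> conj_seq w) 1 = Nm (w 1) (w 0)" "(w \<otimes>\<^bsub>SG\<^esub> conj_seq w) 0 = \<zero>"
proof -
  note cl = rec_closed[OF w, of 1] rec_closed[OF w, of 0] P_closed Q_closed
  show "(w \<otimes>\<^bsub>SG\<^esub> conj_seq w) 1 = Nm (w 1) (w 0)"
    unfolding mult_1[OF w conj_seq(1)[OF w]] conj_seq[OF w] Lam_eq[OF cl(1,2)] using cl by algebra
  show "(w \<otimes>\<^bsub>SG\<^esub> conj_seq w) 0 = \<zero>"
    unfolding mult_0[OF w conj_seq(1)[OF w]] conj_seq[OF w] using cl by algebra
qed

lemma conj_mult:
  assumes w: "w \<in> RS" and v: "v \<in> RS"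
  shows "conj_seq (w \<otimes>\<^bsub>SG\<^esub> v) = conj_seq w \<otimes>\<^bsub>SG\<^esub> conj_seq v"
proof (rule rec_seqs_eqI)
  note cl = rec_closed[OF w, of 1] rec_closed[OF w, of 0] rec_closed[OF v, of 1] rec_closed[OF v,
      of 0]
    P_closed Q_closed
  note wv = mult_closed[OF w v] and cwv = conj_seq(1)[OF w] conj_seq(1)[OF v]
  show "conj_seq (w \<otimes>\<^bsub>SG\<^esub> v) \<in> RS" "conj_seq w \<otimes>\<^bsub>SG\<^esub> conj_seq v \<in> RS"
    using wv cwv by simp_all
  show "conj_seq (w \<otimes>\<^bsub>SG\<^esub> v) 1 = (conj_seq w \<otimes>\<^bsub>SG\<^esub> conj_seq v) 1"
    unfolding mult_1[OF cwv] conj_seq[OF wv] conj_seq[OF w] conj_seq[OF v] mult_1[OF w v]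
        mult_0[OF w v]
    using cl by algebra
  show "conj_seq (w \<otimes>\<^bsub>SG\<^esub> v) 0 = (conj_seq w \<otimes>\<^bsub>SG\<^esub> conj_seq v) 0"
    unfolding mult_0[OF cwv] conj_seq[OF wv] conj_seq[OF w] conj_seq[OF v] mult_0[OF w v]
    using cl by algebra
qed

text \<open>An element times its conjugate is a scalar, the norm. Conjugation is multiplicative, so
  rearranging the four factors exhibits the norm of the product as a product of two scalars.\<close>

lemma Lam_mult:
  assumes w: "w \<in> RS" and v: "v \<in> RS"
  shows "Nm ((w \<otimes>\<^bsub>SG\<^esub> v) 1) ((w \<otimes>\<^bsub>SG\<^esub> v) 0) = Nm (w 1) (w 0) \<otimes> Nm (v 1) (v 0)"
proof -
  let ?w = "conj_seq w" and ?v = "conj_seq v"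
  note RS = w v conj_seq(1)[OF w] conj_seq(1)[OF v]
  have "w \<otimes>\<^bsub>SG\<^esub> v \<otimes>\<^bsub>SG\<^esub> (?w \<otimes>\<^bsub>SG\<^esub> ?v) = w \<otimes>\<^bsub>SG\<^esub> v \<otimes>\<^bsub>SG\<^esub> ?w \<otimes>\<^bsub>SG\<^esub> ?v"
    by (rule mult_assoc[OF mult_closed[OF RS(1,2)] RS(3,4), symmetric])
  also have "\<dots> = w \<otimes>\<^bsub>SG\<^esub> ?w \<otimes>\<^bsub>SG\<^esub> v \<otimes>\<^bsub>SG\<^esub> ?v"
    by (simp only: mult_right_comm[OF RS(1,2,3)])
  also have "\<dots> = w \<otimes>\<^bsub>SG\<^esub> ?w \<otimes>\<^bsub>SG\<^esub> (v \<otimes>\<^bsub>SG\<^esub> ?v)"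
    by (rule mult_assoc[OF mult_closed[OF RS(1,3)] RS(2,4)])
  finally have eq: "w \<otimes>\<^bsub>SG\<^esub> v \<otimes>\<^bsub>SG\<^esub> conj_seq (w \<otimes>\<^bsub>SG\<^esub> v) = w \<otimes>\<^bsub>SG\<^esub> ?w \<otimes>\<^bsub>SG\<^esub> (v \<otimes>\<^bsub>SG\<^esub> ?v)"
    by (simp only: conj_mult[OF w v])
  have "Nm ((w \<otimes>\<^bsub>SG\<^esub> v) 1) ((w \<otimes>\<^bsub>SG\<^esub> v) 0) = (w \<otimes>\<^bsub>SG\<^esub> ?w \<otimes>\<^bsub>SG\<^esub> (v \<otimes>\<^bsub>SG\<^esub> ?v)) 1"
    unfolding eq[symmetric] by (rule mult_conj(1)[OF mult_closed[OF w v], symmetric])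
  also have "\<dots> = Nm (w 1) (w 0) \<otimes> Nm (v 1) (v 0)"
    unfolding mult_1[OF mult_closed[OF RS(1,3)] mult_closed[OF RS(2,4)]] mult_conj[OF w]
        mult_conj[OF v]
    using RS by (simp add: a_minus_def)
  finally show ?thesis .
qed

lemma Lam_scale:
  assumes "c \<in> carrier R" "x \<in> carrier R" "y \<in> carrier R"
  shows "Nm (c \<otimes> x) (c \<otimes> y) = c \<otimes> c \<otimes> Nm x y"
  using assms P_closed Q_closed by (simp only: Lam_eq m_closed) algebra

text \<open>The shift is multiplication by \<theta>, an element of norm Q.\<close>

lemma Lam_step:
  assumes w: "w \<in> RS"
  shows "Nm (w (n + 2)) (w (n + 1)) = Q \<otimes> Nm (w (n + 1)) (w n)"
proof -
  note cl = rec_closed[OF w, of "n + 1"] rec_closed[OF w, of n] P_closed Q_closed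
  then show ?thesis
    by (simp only: rec_up[OF w] Lam_eq minus_closed m_closed) algebra
qed

lemma Units_mult_iff:
  "x \<in> Units R \<Longrightarrow> y \<in> carrier R \<Longrightarrow> x \<otimes> y \<in> Units R \<longleftrightarrow> y \<in> Units R"
  by (metis Units_m_closed m_comm Units_closed unit_factor)

lemma Lam_unit_shift:
  assumes w: "w \<in> RS"
  shows "Nm (w (n + 1)) (w n) \<in> Units R \<longleftrightarrow> Nm (w 1) (w 0) \<in> Units R"
proof (induction n rule: int_induct[where k = 0])
  case base
  then show ?case by simp
next
  case (step1 i)
  then show ?case using Lam_step[OF w, of i] w by (simp add: Units_mult_iff add.assoc)
next
  case (step2 i)
  then show ?case using Lam_step[OF w, of "i - 1"] w by (simp add: Units_mult_iff algebra_simps)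
qed

lemma carrier_seq_group: "w \<in> carrier SG \<longleftrightarrow> w \<in> RS \<and> Nm (w 1) (w 0) \<in> Units R"
  by (simp add: seq_group_def)

lemma carrier_scale_shift:
  assumes "w \<in> carrier SG" "c \<in> Units R"
  shows "(\<lambda>n. c \<otimes> w (n + m)) \<in> carrier SG"
  using assms Lam_unit_shift[of w m] rec_seqs_scale[OF rec_seqs_shift[of w m], of c]
      Units_closed[of c]
  by (simp add: carrier_seq_group Lam_scale Units_mult_iff add.commute)

lemma conj_inverse:
  assumes w: "w \<in> carrier SG"
  defines "y \<equiv> \<lambda>n. inv Nm (w 1) (w 0) \<otimes> conj_seq w n"
  shows "y \<in> carrier SG" "y \<otimes>\<^bsub>SG\<^esub> w = \<one>\<^bsub>SG\<^esub>"
proof -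
  let ?N = "Nm (w 1) (w 0)"
  have RS: "w \<in> RS" "conj_seq w \<in> RS" and N: "?N \<in> Units R"
    using w by (auto simp: carrier_seq_group)
  have y: "y \<in> RS"
    unfolding y_def using RS(2) N by (intro rec_seqs_scale) simp_all
  have "y \<otimes>\<^bsub>SG\<^esub> w = (\<lambda>n. inv ?N \<otimes> (w \<otimes>\<^bsub>SG\<^esub> conj_seq w) (n + 0))"
    using mult_scale_shift[OF RS(2,1) Units_inv_closed[OF N], of 0] mult_comm[OF RS]
    by (simp add: y_def)
  then have "(y \<otimes>\<^bsub>SG\<^esub> w) 1 = \<one>" "(y \<otimes>\<^bsub>SG\<^esub> w) 0 = \<zero>"
    using N mult_conj[OF RS(1)] by simp_all
  then show yw: "y \<otimes>\<^bsub>SG\<^esub> w = \<one>\<^bsub>SG\<^esub>"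
    using y RS(1) by (intro rec_seqs_eqI) (simp_all only: mult_closed one_rec)
  \<comment> \<open>That y lies in the group is read off from multiplicativity: its norm times the
    unit \<open>?N\<close> is the norm of the Lucas sequence, which is 1.\<close>
  have "Nm (y 1) (y 0) \<otimes> ?N = \<one>"
    using Lam_mult[OF y RS(1)] by (simp only: yw one_rec Lam_one)
  then have "?N \<otimes> Nm (y 1) (y 0) \<in> Units R"
    using y RS(1) by (simp add: m_comm)
  then have "Nm (y 1) (y 0) \<in> Units R"
    using y Units_mult_iff[OF N, of "Nm (y 1) (y 0)"] by simp
  then show "y \<in> carrier SG"
    using y by (simp only: carrier_seq_group)
qed

sublocale SG: comm_group SG
proof (rule comm_groupI)
  show "\<one>\<^bsub>SG\<^esub> \<in> carrier SG"
    by (simp add: carrier_seq_group Lam_one)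
  show "w \<otimes>\<^bsub>SG\<^esub> v = v \<otimes>\<^bsub>SG\<^esub> w" if "w \<in> carrier SG" "v \<in> carrier SG" for w v
    using that by (simp add: carrier_seq_group mult_comm)
  show "\<exists>y\<in>carrier SG. y \<otimes>\<^bsub>SG\<^esub> w = \<one>\<^bsub>SG\<^esub>" if "w \<in> carrier SG" for w
    using conj_inverse[OF that] by blast
qed (simp_all add: carrier_seq_group Lam_mult mult_assoc mult_one)

lemma inv_seq:
  assumes w: "w \<in> carrier SG"
  shows "inv\<^bsub>SG\<^esub> w = (\<lambda>n. inv Nm (w 1) (w 0) \<otimes> conj_seq w n)"
  using conj_inverse[OF w] w by (intro SG.inv_equality)

section \<open>Scaling and shifting as congruences\<close>

lemma shift_rel_equiv:
  assumes S: "S \<subseteq> RS"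
  shows "equiv S (shift_rel R S)"
proof (intro equivI refl_onI symI transI)
  show "shift_rel R S \<subseteq> S \<times> S"
    by (auto simp: shift_rel_def)
  show "(w, w) \<in> shift_rel R S" if "w \<in> S" for w
    using that S unfolding shift_rel_def by (force intro: bexI[of _ \<one>] exI[of _ 0])
  show "(v, w) \<in> shift_rel R S" if "(w, v) \<in> shift_rel R S" for w v
  proof -
    from that obtain c m where *: "w \<in> S" "v \<in> S" "c \<in> Units R" "\<And>n. w n = c \<otimes> v (n + m)"
      by (auto simp: shift_rel_def)
    then have "v n = inv c \<otimes> w (n + - m)" for n
      using S by (auto simp: m_assoc[symmetric] Units_closed)
    then show ?thesis
      using * by (auto simp: shift_rel_def intro!: bexI[of _ "inv c"] exI[of _ "- m"])
  qed
  show "(u, v) \<in> shift_rel R S" if "(u, w) \<in> shift_rel R S" "(w, v) \<in> shift_rel R S" for u w v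
  proof -
    from that obtain c m d k where *: "u \<in> S" "v \<in> S" "c \<in> Units R" "d \<in> Units R"
        "\<And>n. u n = c \<otimes> w (n + m)" "\<And>n. w n = d \<otimes> v (n + k)"
      by (auto simp: shift_rel_def)
    then have "u n = (c \<otimes> d) \<otimes> v (n + (m + k))" for n
      using S by (auto simp: m_assoc Units_closed add.assoc)
    then show ?thesis
      using * by (auto simp: shift_rel_def intro!: bexI[of _ "c \<otimes> d"] exI[of _ "m + k"])
  qed
qed

lemma scale_rel_equiv:
  assumes S: "S \<subseteq> RS"
  shows "equiv S (scale_rel R S)"
proof (intro equivI refl_onI symI transI)
  show "scale_rel R S \<subseteq> S \<times> S"
    by (auto simp: scale_rel_def)
  show "(w, w) \<in> scale_rel R S" if "w \<in> S" for w
    using that S unfolding scale_rel_def by (force intro: bexI[of _ \<one>])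
  show "(v, w) \<in> scale_rel R S" if "(w, v) \<in> scale_rel R S" for w v
  proof -
    from that obtain c where *: "w \<in> S" "v \<in> S" "c \<in> Units R" "\<And>n. w n = c \<otimes> v n"
      by (auto simp: scale_rel_def)
    then have "v n = inv c \<otimes> w n" for n
      using S by (auto simp: m_assoc[symmetric] Units_closed)
    then show ?thesis
      using * by (auto simp: scale_rel_def intro!: bexI[of _ "inv c"])
  qed
  show "(u, v) \<in> scale_rel R S" if "(u, w) \<in> scale_rel R S" "(w, v) \<in> scale_rel R S" for u w v
  proof -
    from that obtain c d where *: "u \<in> S" "v \<in> S" "c \<in> Units R" "d \<in> Units R"
        "\<And>n. u n = c \<otimes> w n" "\<And>n. w n = d \<otimes> v n"
      by (auto simp: scale_rel_def)
    then have "u n = (c \<otimes> d) \<otimes> v n" for n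
      using S by (auto simp: m_assoc Units_closed)
    then show ?thesis
      using * by (auto simp: scale_rel_def intro!: bexI[of _ "c \<otimes> d"])
  qed
qed

lemma mult_scale_shift_both:
  assumes "w \<in> RS" "v \<in> RS" "c \<in> carrier R" "d \<in> carrier R"
  shows "(\<lambda>n. c \<otimes> w (n + m)) \<otimes>\<^bsub>SG\<^esub> (\<lambda>n. d \<otimes> v (n + k)) =
    (\<lambda>n. (c \<otimes> d) \<otimes> (w \<otimes>\<^bsub>SG\<^esub> v) (n + (m + k)))"
proof -
  let ?v = "\<lambda>n. d \<otimes> v (n + k)"
  have v': "?v \<in> RS"
    using assms by (intro rec_seqs_scale rec_seqs_shift)
  have "w \<otimes>\<^bsub>SG\<^esub> ?v = (\<lambda>n. d \<otimes> (w \<otimes>\<^bsub>SG\<^esub> v) (n + k))"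
    using assms v' by (simp only: mult_comm[of w] mult_scale_shift)
  then have "(\<lambda>n. c \<otimes> w (n + m)) \<otimes>\<^bsub>SG\<^esub> ?v = (\<lambda>n. c \<otimes> (d \<otimes> (w \<otimes>\<^bsub>SG\<^esub> v) (n + m + k)))"
    by (simp only: mult_scale_shift[OF assms(1) v' assms(3)])
  then show ?thesis
    using assms by (simp add: m_assoc add.assoc)
qed

text \<open>S stays arbitrary because the relation is used both on the full group and on the
  eventually integral sequences, which need not form a subgroup. In a product the scalars multiply
  and the shifts add.\<close>

lemma shift_rel_mult:
  assumes S: "S \<subseteq> RS" "\<And>w v. w \<in> S \<Longrightarrow> v \<in> S \<Longrightarrow> w \<otimes>\<^bsub>SG\<^esub> v \<in> S"
    and "(w, w') \<in> shift_rel R S" "(v, v') \<in> shift_rel R S"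
  shows "(w \<otimes>\<^bsub>SG\<^esub> v, w' \<otimes>\<^bsub>SG\<^esub> v') \<in> shift_rel R S"
proof -
  from assms(3,4) obtain c m d k where *: "w \<in> S" "v \<in> S" "w' \<in> S" "v' \<in> S"
      and cd: "c \<in> Units R" "d \<in> Units R"
      and eq: "w = (\<lambda>n. c \<otimes> w' (n + m))" "v = (\<lambda>n. d \<otimes> v' (n + k))"
    unfolding shift_rel_def fun_eq_iff by blast
  have "w \<otimes>\<^bsub>SG\<^esub> v = (\<lambda>n. (c \<otimes> d) \<otimes> (w' \<otimes>\<^bsub>SG\<^esub> v') (n + (m + k)))"
    unfolding eq using * S cd by (intro mult_scale_shift_both Units_closed) auto
  then show ?thesis
    using S(2)[OF *(1,2)] S(2)[OF *(3,4)] Units_m_closed[OF cd]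
    unfolding shift_rel_def fun_eq_iff by blast
qed

lemma scale_rel_mult:
  assumes S: "S \<subseteq> RS" "\<And>w v. w \<in> S \<Longrightarrow> v \<in> S \<Longrightarrow> w \<otimes>\<^bsub>SG\<^esub> v \<in> S"
    and "(w, w') \<in> scale_rel R S" "(v, v') \<in> scale_rel R S"
  shows "(w \<otimes>\<^bsub>SG\<^esub> v, w' \<otimes>\<^bsub>SG\<^esub> v') \<in> scale_rel R S"
proof -
  from assms(3,4) obtain c d where *: "w \<in> S" "v \<in> S" "w' \<in> S" "v' \<in> S"
      and cd: "c \<in> Units R" "d \<in> Units R"
      \<comment> \<open>The trivial shift is written out so that
        \<open>mult_scale_shift_both\<close> matches.\<close>
      and eq: "w = (\<lambda>n. c \<otimes> w' (n + 0))" "v = (\<lambda>n. d \<otimes> v' (n + 0))"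
    unfolding scale_rel_def fun_eq_iff add_0_right by blast
  have "w \<otimes>\<^bsub>SG\<^esub> v = (\<lambda>n. (c \<otimes> d) \<otimes> (w' \<otimes>\<^bsub>SG\<^esub> v') (n + (0 + 0)))"
    unfolding eq using * S cd by (intro mult_scale_shift_both Units_closed) auto
  then show ?thesis
    using S(2)[OF *(1,2)] S(2)[OF *(3,4)] Units_m_closed[OF cd]
    unfolding scale_rel_def fun_eq_iff add_0_right by blast
qed

lemma carrier_sub_RS: "carrier SG \<subseteq> RS"
  by (auto simp: carrier_seq_group)

definition "cls w = scale_rel R (carrier SG) `` {w}"
definition "scls w = shift_rel R (carrier SG) `` {w}"

lemma G_quot: "comm_group (G_grp R P Q)" "group_hom SG (G_grp R P Q) cls"
  "carrier (G_grp R P Q) = cls ` carrier SG"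
  unfolding G_grp_def cls_def[abs_def]
  by (intro quot_monoid_hom SG.comm_group_axioms scale_rel_equiv scale_rel_mult carrier_sub_RS
      SG.m_closed; assumption)+

lemma Gs_quot: "comm_group (Gs_grp R P Q)" "group_hom SG (Gs_grp R P Q) scls"
  "carrier (Gs_grp R P Q) = scls ` carrier SG"
  unfolding Gs_grp_def scls_def[abs_def]
  by (intro quot_monoid_hom SG.comm_group_axioms shift_rel_equiv shift_rel_mult carrier_sub_RS
      SG.m_closed; assumption)+

lemma cls_eq_iff:
  assumes "w \<in> carrier SG" "v \<in> carrier SG"
  shows "cls w = cls v \<longleftrightarrow> (\<exists>c\<in>Units R. w = (\<lambda>n. c \<otimes> v n))"
  using assms eq_equiv_class_iff[OF scale_rel_equiv[OF carrier_sub_RS] assms]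
  by (auto simp: cls_def scale_rel_def fun_eq_iff)

lemma scls_eq_iff:
  assumes "w \<in> carrier SG" "v \<in> carrier SG"
  shows "scls w = scls v \<longleftrightarrow> (\<exists>c\<in>Units R. \<exists>m. w = (\<lambda>n. c \<otimes> v (n + m)))"
  using assms eq_equiv_class_iff[OF shift_rel_equiv[OF carrier_sub_RS] assms]
  by (auto simp: scls_def shift_rel_def fun_eq_iff)

lemma mem_cls_iff: "w \<in> carrier SG \<Longrightarrow> v \<in> cls w \<longleftrightarrow> v \<in> carrier SG \<and> cls v = cls w"
  using equiv_class_eq_iff[OF scale_rel_equiv[OF carrier_sub_RS], of w v] by (auto simp: cls_def)

lemma mem_scls_iff: "w \<in> carrier SG \<Longrightarrow> v \<in> scls w \<longleftrightarrow> v \<in> carrier SG \<and> scls v = scls w"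
  using equiv_class_eq_iff[OF shift_rel_equiv[OF carrier_sub_RS], of w v] by (auto simp: scls_def)

end

section \<open>Roots of a subgroup\<close>

definition radical :: "('a, 'b) monoid_scheme \<Rightarrow> 'a set \<Rightarrow> 'a set" where
  "radical G H = {x \<in> carrier G. \<exists>n::int. n \<noteq> 0 \<and> x [^]\<^bsub>G\<^esub> n \<in> H}"

lemma (in group) subset_radical: "H \<subseteq> carrier G \<Longrightarrow> H \<subseteq> radical G H"
  unfolding radical_def by (auto intro!: exI[of _ "1::int"] simp: int_pow_1)

text \<open>Commutativity enters through (x y)^(n m) = (x^n)^m (y^m)^n, a product of powers of
  members of H.\<close>

lemma (in comm_group) radical_subgroup:
  assumes H: "subgroup H G"
  shows "subgroup (radical G H) G"
proof (rule subgroupI)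
  show "radical G H \<subseteq> carrier G"
    by (auto simp: radical_def)
  show "radical G H \<noteq> {}"
    using subset_radical[OF subgroup.subset[OF H]] subgroup.one_closed[OF H] by blast
  show "inv x \<in> radical G H" if "x \<in> radical G H" for x
    using that H by (auto simp: radical_def int_pow_inv subgroup.m_inv_closed)
  show "x \<otimes> y \<in> radical G H" if xy: "x \<in> radical G H" "y \<in> radical G H" for x y
  proof -
    obtain n m :: int where nm: "x \<in> carrier G" "y \<in> carrier G" "n \<noteq> 0" "m \<noteq> 0" "x [^] n \<in> H"
        "y [^] m \<in> H"
      using xy by (auto simp: radical_def)
    have "(x \<otimes> y) [^] (n * m) = (x [^] n) [^] m \<otimes> (y [^] m) [^] n"
      using nm by (simp add: int_pow_mult_distrib m_comm int_pow_pow mult.commute)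
    also have "\<dots> \<in> H"
      using subgroup.m_closed[OF H subgroup_int_pow_closed[OF H nm(5)]
          subgroup_int_pow_closed[OF H nm(6)]] .
    finally show ?thesis
      using nm by (auto simp: radical_def intro!: exI[of _ "n * m"])
  qed
qed

lemma (in comm_group) radical_pow_iff:
  assumes H: "subgroup H G" and x: "x \<in> carrier G" "n \<noteq> 0" "x [^] (n::int) \<in> radical G H"
  shows "x \<in> radical G H"
  using assms by (auto simp: radical_def int_pow_pow) (metis mult_eq_0_iff)

text \<open>If a power of h x lies in the image of A, then x^n = k a with a in A and k only in the
  kernel. As k has a power in A, x^n lies in the radical, and hence so does x.\<close>

lemma radical_image:
  assumes h: "group_hom G K h" and G: "comm_group G" and surj: "h ` carrier G = carrier K"
    and A: "subgroup A G" and ker: "kernel G K h \<subseteq> radical G A"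
  shows "h ` radical G A = radical K (h ` A)"
proof -
  interpret group_hom G K h by (rule h)
  interpret G: comm_group G by (rule G)
  interpret rad: subgroup "radical G A" G by (rule G.radical_subgroup[OF A])
  have down: "x \<in> radical G A" if x: "x \<in> carrier G" and n: "n \<noteq> 0" "h x [^]\<^bsub>K\<^esub> n \<in> h ` A" for x
      and n :: int
  proof -
    obtain a where a: "a \<in> A" "h x [^]\<^bsub>K\<^esub> n = h a"
      using n by blast
    then have aG: "a \<in> carrier G"
      using subgroup.subset[OF A] by blast
    have "h (x [^]\<^bsub>G\<^esub> n \<otimes>\<^bsub>G\<^esub> inv\<^bsub>G\<^esub> a) = \<one>\<^bsub>K\<^esub>"
      using x a aG by (simp add: hom_int_pow)
    then have "x [^]\<^bsub>G\<^esub> n \<otimes>\<^bsub>G\<^esub> inv\<^bsub>G\<^esub> a \<in> radical G A"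
      using x aG ker by (auto simp: kernel_def)
    moreover have "a \<in> radical G A"
      using a G.subset_radical[OF subgroup.subset[OF A]] by blast
    ultimately have "x [^]\<^bsub>G\<^esub> n \<otimes>\<^bsub>G\<^esub> inv\<^bsub>G\<^esub> a \<otimes>\<^bsub>G\<^esub> a \<in> radical G A"
      by (rule rad.m_closed)
    then show ?thesis
      using x aG n(1) by (intro G.radical_pow_iff[OF A x n(1)]) (simp add: G.m_assoc)
  qed
  have up: "h x \<in> radical K (h ` A)" if "x \<in> radical G A" for x
  proof -
    from that obtain n :: int where n: "x \<in> carrier G" "n \<noteq> 0" "x [^]\<^bsub>G\<^esub> n \<in> A"
      unfolding radical_def by blast
    then have "h x [^]\<^bsub>K\<^esub> n \<in> h ` A"
      using hom_int_pow[of x n] by (metis image_eqI)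
    with n show ?thesis
      unfolding radical_def using hom_closed by blast
  qed
  show ?thesis
  proof (intro equalityI subsetI)
    fix y assume "y \<in> radical K (h ` A)"
    then obtain n :: int where "y \<in> carrier K" "n \<noteq> 0" "y [^]\<^bsub>K\<^esub> n \<in> h ` A"
      unfolding radical_def by blast
    then show "y \<in> h ` radical G A"
      using down unfolding surj[symmetric] by blast
  qed (use up in blast)
qed

text \<open>Serves to pull subgroups of the rational group back to Laxton's group, through the
  inverse isomorphism.\<close>

lemma subgroup_iso_vimage:
  assumes "group G" "group K" "h \<in> iso G K" "A \<subseteq> carrier G" "subgroup (h ` A) K"
  shows "subgroup A G"
proof -
  let ?g = "inv_into (carrier G) h"
  have "?g \<in> hom K G"
    using group.iso_set_sym[OF assms(1,3)] by (simp add: iso_def)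
  then interpret group_hom K G ?g
    using assms by (simp add: group_hom_def group_hom_axioms_def)
  have "?g ` h ` A = A"
    using assms by (intro inv_into_image_cancel) (auto simp: iso_def bij_betw_def)
  then show ?thesis
    using subgroup_img_is_subgroup[OF assms(5)] by simp
qed

section \<open>Localization at p\<close>

lemma rat_ring_simps [simp]:
  "carrier rat_ring = UNIV" "x \<otimes>\<^bsub>rat_ring\<^esub> y = x * y" "x \<oplus>\<^bsub>rat_ring\<^esub> y = x + y"
  "\<one>\<^bsub>rat_ring\<^esub> = 1" "\<zero>\<^bsub>rat_ring\<^esub> = 0"
  by (simp_all add: ring_of_type_algebra_def)

lemma rat_ring_minus [simp]: "\<ominus>\<^bsub>rat_ring\<^esub> x = - x" "x \<ominus>\<^bsub>rat_ring\<^esub> y = x - y"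
proof -
  interpret cring rat_ring by (rule cring_from_type_algebra)
  show *: "\<ominus>\<^bsub>rat_ring\<^esub> x = - x" for x
    by (rule minus_equality) simp_all
  show "x \<ominus>\<^bsub>rat_ring\<^esub> y = x - y"
    by (simp add: a_minus_def *)
qed

lemma rat_ring_Units [simp]: "Units rat_ring = - {0}"
proof -
  interpret field rat_ring by (rule field_from_type_algebra)
  show ?thesis using field_Units by auto
qed

lemma rat_ring_inv [simp]: "x \<noteq> 0 \<Longrightarrow> inv\<^bsub>rat_ring\<^esub> x = inverse x"
proof -
  interpret cring rat_ring by (rule cring_from_type_algebra)
  show "inv\<^bsub>rat_ring\<^esub> x = inverse x" if "x \<noteq> 0"
    by (rule comm_inv_char) (use that in simp_all)
qed

lemma rat_ring_Lam: "Lam rat_ring P Q x y = x^2 - P * y * x + Q * y^2"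
proof -
  have "Lam rat_ring P Q x y = x * x - P * y * x + Q * (y * y)"
    using cring.Lam_eq[OF cring_from_type_algebra, of x y P Q] by simp
  then show ?thesis by (simp add: power2_eq_square)
qed

section \<open>The local ring Z_(p) and its maximal ideal\<close>

definition p_local_ring :: "nat \<Rightarrow> rat set" where
  "p_local_ring p = {of_int a / of_int b | a b. \<not> int p dvd b}"

locale prime_localization =
  fixes p :: nat
  assumes p_prime: "prime p"
begin

abbreviation "Zp \<equiv> p_local_ring p"
abbreviation "I \<equiv> p_local_ideal p"

sublocale F: residues_prime p "residue_ring (int p)"
  using p_prime by unfold_locales

lemma prime_int_p: "prime (int p)"
  using p_prime by simp

text \<open>Clearing the denominator instead of exhibiting a quotient turns closure under sums and
  products into integer polynomial identities.\<close>

lemma ZpI: "\<not> int p dvd b \<Longrightarrow> x * of_int b = of_int a \<Longrightarrow> x \<in> Zp"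
proof -
  assume b: "\<not> int p dvd b" and eq: "x * of_int b = of_int a"
  then have "b \<noteq> 0" by auto
  with eq have "x = of_int a / of_int b"
    by (simp add: nonzero_eq_divide_eq)
  with b show ?thesis
    unfolding p_local_ring_def by blast
qed

lemma ZpE:
  assumes "x \<in> Zp"
  obtains a b where "\<not> int p dvd b" "b \<noteq> 0" "x * of_int b = of_int a"
  using assms unfolding p_local_ring_def by (auto simp: field_simps intro: that)

lemma II: "\<not> int p dvd b \<Longrightarrow> x * of_int b = of_int a \<Longrightarrow> int p dvd a \<Longrightarrow> x \<in> I"
proof -
  assume b: "\<not> int p dvd b" and eq: "x * of_int b = of_int a" and "int p dvd a"
  then obtain k where "a = int p * k" "b \<noteq> 0" by auto
  with eq have "x = of_int (int p * k) / of_int b"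
    by (simp add: nonzero_eq_divide_eq)
  with b show ?thesis
    unfolding p_local_ideal_def by blast
qed

lemma IE:
  assumes "x \<in> I"
  obtains a b where "\<not> int p dvd b" "b \<noteq> 0" "x * of_int b = of_int a" "int p dvd a"
proof -
  obtain a b where ab: "\<not> int p dvd b" "x = of_int (int p * a) / of_int b"
    using assms unfolding p_local_ideal_def by auto
  then have "b \<noteq> 0" by auto
  with ab show ?thesis by (intro that[of b "int p * a"]) auto
qed

lemma I_sub_Zp: "x \<in> I \<Longrightarrow> x \<in> Zp"
  by (erule IE) (rule ZpI)

text \<open>Divisibility of the numerator does not depend on the chosen fraction: cross-multiply and
  use that p is prime.\<close>

lemma mem_I_iff:
  assumes "\<not> int p dvd b" "x * of_int b = of_int a"
  shows "x \<in> I \<longleftrightarrow> int p dvd a"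
proof
  assume "x \<in> I"
  then obtain c d where cd: "\<not> int p dvd d" "x * of_int d = of_int c" "int p dvd c"
    by (rule IE)
  have "(of_int (a * d) :: rat) = x * of_int b * of_int d"
    using assms by simp
  also have "\<dots> = of_int (c * b)"
    using cd by (simp add: mult_ac flip: cd(2))
  finally have "a * d = c * b"
    by (simp only: of_int_eq_iff)
  then have "int p dvd a * d"
    using cd by simp
  then show "int p dvd a"
    using cd prime_int_p by (simp add: prime_dvd_mult_iff)
qed (use assms II in blast)

lemma not_dvd_mult: "\<not> int p dvd b \<Longrightarrow> \<not> int p dvd d \<Longrightarrow> \<not> int p dvd b * d"
  using prime_int_p by (simp add: prime_dvd_mult_iff)

lemma Zp_of_int [simp]: "of_int a \<in> Zp"
  using prime_int_p by (intro ZpI[of 1 _ a]) auto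

lemma Zp_0_1 [simp]: "0 \<in> Zp" "1 \<in> Zp"
  using Zp_of_int[of 0] Zp_of_int[of 1] by simp_all

lemma Zp_add [simp]: assumes "x \<in> Zp" "y \<in> Zp" shows "x + y \<in> Zp"
proof -
  from assms obtain a b c d where "\<not> int p dvd b" "x * of_int b = of_int a" "\<not> int p dvd d"
      "y * of_int d = of_int c"
    by (metis ZpE)
  then show ?thesis
    by (intro ZpI[of "b * d" _ "a * d + c * b"] not_dvd_mult)
        (simp_all add: algebra_simps flip: \<open>_ = of_int a\<close> \<open>_ = of_int c\<close>)
qed

lemma Zp_mult [simp]: assumes "x \<in> Zp" "y \<in> Zp" shows "x * y \<in> Zp"
proof -
  from assms obtain a b c d where "\<not> int p dvd b" "x * of_int b = of_int a" "\<not> int p dvd d"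
      "y * of_int d = of_int c"
    by (metis ZpE)
  then show ?thesis
    by (intro ZpI[of "b * d" _ "a * c"] not_dvd_mult) (simp_all add: algebra_simps flip: \<open>_
        = of_int a\<close> \<open>_ = of_int c\<close>)
qed

lemma Zp_uminus [simp]: "x \<in> Zp \<Longrightarrow> - x \<in> Zp"
  using Zp_mult[OF Zp_of_int[of "- 1"], of x] by simp

lemma Zp_diff [simp]: "x \<in> Zp \<Longrightarrow> y \<in> Zp \<Longrightarrow> x - y \<in> Zp"
  using Zp_add[of x "- y"] by simp

lemma I_of_int: "of_int a \<in> I \<longleftrightarrow> int p dvd a"
  using not_prime_unit[of "int p"] prime_int_p by (intro mem_I_iff[of 1]) auto

lemma I_mult_iff:
  assumes "x \<in> Zp" "y \<in> Zp"
  shows "x * y \<in> I \<longleftrightarrow> x \<in> I \<or> y \<in> I"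
proof -
  from assms obtain a b c d where *: "\<not> int p dvd b" "x * of_int b = of_int a" "\<not> int p dvd d"
      "y * of_int d = of_int c"
    by (metis ZpE)
  have "x * y * of_int (b * d) = of_int (a * c)"
    by (simp add: algebra_simps flip: *(2,4))
  from mem_I_iff[OF not_dvd_mult[OF *(1,3)] this] show ?thesis
    using mem_I_iff[OF *(1,2)] mem_I_iff[OF *(3,4)] prime_int_p by (simp add: prime_dvd_mult_iff)
qed

lemma I_0 [simp]: "0 \<in> I"
  using I_of_int[of 0] by simp

lemma I_1 [simp]: "1 \<notin> I"
  using I_of_int[of 1] prime_int_p by auto

lemma I_add [simp]: assumes "x \<in> I" "y \<in> I" shows "x + y \<in> I"
proof -
  from assms obtain a b c d where *: "\<not> int p dvd b" "x * of_int b = of_int a" "int p dvd a"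
      "\<not> int p dvd d" "y * of_int d = of_int c" "int p dvd c"
    by (metis IE)
  then show ?thesis
    by (intro II[of "b * d" _ "a * d + c * b"] not_dvd_mult)
        (simp_all add: algebra_simps flip: *(2,5))
qed

lemma I_uminus [simp]: "x \<in> I \<Longrightarrow> - x \<in> I"
  using I_mult_iff[of "of_int (- 1)" x] I_sub_Zp by simp

lemma I_diff [simp]: "x \<in> I \<Longrightarrow> y \<in> I \<Longrightarrow> x - y \<in> I"
  using I_add[of x "- y"] by simp

text \<open>Z_(p) is local: outside I the numerator is prime to p, so the fraction can be turned
  upside down.\<close>

lemma Zp_inverse:
  assumes "x \<in> Zp" "x \<notin> I"
  shows "inverse x \<in> Zp" "inverse x \<notin> I" "x \<noteq> 0"
proof -
  obtain a b where ab: "\<not> int p dvd b" "b \<noteq> 0" "x * of_int b = of_int a"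
    using assms(1) by (rule ZpE)
  then have a: "\<not> int p dvd a"
    using mem_I_iff[OF ab(1,3)] assms by simp
  show x: "x \<noteq> 0"
    using assms by auto
  have eq: "inverse x * of_int a = of_int b"
    using x by (simp flip: ab(3))
  show "inverse x \<in> Zp" "inverse x \<notin> I"
    using ZpI[OF a eq] mem_I_iff[OF a eq] ab by auto
qed

section \<open>The residue map from Z_(p) to F_p\<close>

definition rd :: "rat \<Rightarrow> int" where
  "rd x = (THE r. 0 \<le> r \<and> r < int p \<and> x - of_int r \<in> I)"

lemma rd_eqI:
  assumes "x - of_int a \<in> I"
  shows "rd x = a mod int p"
  unfolding rd_def
proof (rule the_equality)
  have pos: "int p > 0"
    using prime_int_p prime_gt_0_int by blast
  have "of_int (a - a mod int p) \<in> I"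
    unfolding I_of_int by (simp add: dvd_minus_mod)
  from I_add[OF assms this] show "0 \<le> a mod int p \<and> a mod int p < int p \<and> x - of_int (a mod int p)
      \<in> I"
    using pos by simp
  fix r assume r: "0 \<le> r \<and> r < int p \<and> x - of_int r \<in> I"
  then have "of_int (r - a) \<in> I"
    using I_diff[OF assms, of "x - of_int r"] by simp
  then have "int p dvd r - a"
    by (simp only: I_of_int)
  then have "r mod int p = a mod int p"
    by (simp add: mod_eq_dvd_iff)
  then show "r = a mod int p"
    using r by simp
qed

text \<open>An inverse c of the denominator modulo p replaces a / b by the integer a c.\<close>

lemma rd_exists:
  assumes "x \<in> Zp"
  obtains a where "x - of_int a \<in> I"
proof -
  obtain a b where ab: "\<not> int p dvd b" "b \<noteq> 0" "x * of_int b = of_int a"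
    using assms by (rule ZpE)
  have "coprime b (int p)"
    using ab(1) F.p_coprime_right_int by simp
  then obtain c where c: "[b * c = 1] (mod int p)"
    using cong_solve_coprime_int by blast
  have "(x - of_int (a * c)) * of_int b = of_int (a * (1 - b * c))"
    by (simp add: algebra_simps flip: ab(3))
  moreover have "int p dvd a * (1 - b * c)"
    using c by (simp add: cong_iff_dvd_diff dvd_diff_commute)
  ultimately have "x - of_int (a * c) \<in> I"
    using ab(1) by (intro II)
  then show ?thesis
    by (rule that)
qed

lemma rd_diff_mem: "x \<in> Zp \<Longrightarrow> x - of_int (rd x) \<in> I"
proof -
  assume "x \<in> Zp"
  then obtain a where a: "x - of_int a \<in> I"
    by (rule rd_exists)
  have "of_int (a - a mod int p) \<in> I"
    unfolding I_of_int by (simp add: dvd_minus_mod)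
  from I_add[OF a this] show ?thesis
    by (simp add: rd_eqI[OF a])
qed

lemma rd_of_int: "rd (of_int a) = a mod int p"
  by (rule rd_eqI) simp

lemma rd_closed [simp]: "x \<in> Zp \<Longrightarrow> rd x \<in> carrier (residue_ring (int p))"
  by (metis rd_exists rd_eqI F.mod_in_carrier)

lemma rd_add: "x \<in> Zp \<Longrightarrow> y \<in> Zp \<Longrightarrow> rd (x + y) = rd x \<oplus>\<^bsub>residue_ring (int p)\<^esub> rd y"
  unfolding F.res_add_eq using I_add[OF rd_diff_mem rd_diff_mem, of x y]
  by (intro rd_eqI) (simp add: algebra_simps)

lemma rd_mult:
  assumes "x \<in> Zp" "y \<in> Zp"
  shows "rd (x * y) = rd x \<otimes>\<^bsub>residue_ring (int p)\<^esub> rd y"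
  unfolding F.res_mult_eq
proof (rule rd_eqI)
  have "x * (y - of_int (rd y)) + (x - of_int (rd x)) * of_int (rd y) \<in> I"
    using assms rd_diff_mem by (intro I_add) (simp_all add: I_mult_iff I_sub_Zp)
  then show "x * y - of_int (rd x * rd y) \<in> I"
    by (simp add: algebra_simps)
qed

lemma rd_uminus: "x \<in> Zp \<Longrightarrow> rd (- x) = \<ominus>\<^bsub>residue_ring (int p)\<^esub> rd x"
  unfolding F.res_neg_eq using I_uminus[OF rd_diff_mem, of x]
  by (intro rd_eqI) simp

lemma rd_diff: "x \<in> Zp \<Longrightarrow> y \<in> Zp \<Longrightarrow> rd (x - y) = rd x \<ominus>\<^bsub>residue_ring (int p)\<^esub> rd y"
  using rd_add[of x "- y"] by (simp add: rd_uminus a_minus_def)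

lemma rd_0_1 [simp]: "rd 0 = 0" "rd 1 = 1"
  using rd_of_int[of 0] rd_of_int[of 1] F.m_gt_one by simp_all

lemma rd_eq_0_iff: "x \<in> Zp \<Longrightarrow> rd x = 0 \<longleftrightarrow> x \<in> I"
  using rd_diff_mem[of x] rd_eqI[of x 0] by auto

lemma rd_Units_iff: "x \<in> Zp \<Longrightarrow> rd x \<in> Units (residue_ring (int p)) \<longleftrightarrow> x \<notin> I"
  using rd_eq_0_iff[of x] rd_closed[of x] F.field_Units by (auto simp: F.res_zero_eq)

end

section \<open>Projective points and coprime representatives\<close>

lemma proj_pt_scale:
  assumes "cring F" "c \<in> Units F" "x \<in> carrier F" "y \<in> carrier F"
  shows "proj_pt F (c \<otimes>\<^bsub>F\<^esub> x) (c \<otimes>\<^bsub>F\<^esub> y) = proj_pt F x y"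
proof -
  interpret cring F by fact
  have c: "c \<in> carrier F"
    using assms(2) by (rule Units_closed)
  show ?thesis
  proof (intro equalityI subsetI)
    fix z assume "z \<in> proj_pt F (c \<otimes>\<^bsub>F\<^esub> x) (c \<otimes>\<^bsub>F\<^esub> y)"
    then obtain d where d: "d \<in> Units F" "z = (d \<otimes>\<^bsub>F\<^esub> (c \<otimes>\<^bsub>F\<^esub> x), d \<otimes>\<^bsub>F\<^esub> (c \<otimes>\<^bsub>F\<^esub> y))"
      by (auto simp: proj_pt_def)
    then have "z = ((d \<otimes>\<^bsub>F\<^esub> c) \<otimes>\<^bsub>F\<^esub> x, (d \<otimes>\<^bsub>F\<^esub> c) \<otimes>\<^bsub>F\<^esub> y)"
      using c assms Units_closed[OF d(1)] by (simp add: m_assoc)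
    then show "z \<in> proj_pt F x y"
      using Units_m_closed[OF d(1) assms(2)] unfolding proj_pt_def by blast
  next
    fix z assume "z \<in> proj_pt F x y"
    then obtain d where d: "d \<in> Units F" "z = (d \<otimes>\<^bsub>F\<^esub> x, d \<otimes>\<^bsub>F\<^esub> y)"
      by (auto simp: proj_pt_def)
    have "(d \<otimes>\<^bsub>F\<^esub> inv\<^bsub>F\<^esub> c) \<otimes>\<^bsub>F\<^esub> (c \<otimes>\<^bsub>F\<^esub> u) = d \<otimes>\<^bsub>F\<^esub> u" if u: "u \<in> carrier F" for u
    proof -
      have "(d \<otimes>\<^bsub>F\<^esub> inv\<^bsub>F\<^esub> c) \<otimes>\<^bsub>F\<^esub> (c \<otimes>\<^bsub>F\<^esub> u) = d \<otimes>\<^bsub>F\<^esub> ((inv\<^bsub>F\<^esub> c \<otimes>\<^bsub>F\<^esub> c) \<otimes>\<^bsub>F\<^esub> u)"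
        using c u assms(2) Units_closed[OF d(1)] by (simp only: m_assoc Units_inv_closed m_closed)
      then show ?thesis
        using u assms(2) by simp
    qed
    then have "z = ((d \<otimes>\<^bsub>F\<^esub> inv\<^bsub>F\<^esub> c) \<otimes>\<^bsub>F\<^esub> (c \<otimes>\<^bsub>F\<^esub> x), (d \<otimes>\<^bsub>F\<^esub> inv\<^bsub>F\<^esub> c) \<otimes>\<^bsub>F\<^esub> (c \<otimes>\<^bsub>F\<^esub> y))"
      using d(2) assms by simp
    then show "z \<in> proj_pt F (c \<otimes>\<^bsub>F\<^esub> x) (c \<otimes>\<^bsub>F\<^esub> y)"
      using Units_m_closed[OF d(1) Units_inv_Units[OF assms(2)]] unfolding proj_pt_def by blast
  qed
qed

text \<open>Clear denominators, then divide by the gcd. This supplies the coprime representatives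
  through which both reduction maps are defined.\<close>

lemma rat_pair_coprime:
  fixes x y :: rat
  assumes "x \<noteq> 0 \<or> y \<noteq> 0"
  obtains c :: rat and a b :: int where "c \<noteq> 0" "c * x = of_int a" "c * y = of_int b" "coprime a b"
proof -
  obtain a1 b1 a0 b0 where q: "quotient_of x = (a1, b1)" "quotient_of y = (a0, b0)"
    by (metis surj_pair)
  note pos = quotient_of_denom_pos[OF q(1)] quotient_of_denom_pos[OF q(2)]
  define u v where "u = a1 * b0" and "v = a0 * b1"
  have x: "x * of_int (b1 * b0) = of_int u" and y: "y * of_int (b1 * b0) = of_int v"
    using quotient_of_div[OF q(1)] quotient_of_div[OF q(2)] pos by (simp_all add: u_def v_def)
  have uv: "u \<noteq> 0 \<or> v \<noteq> 0"
    using assms x y pos by auto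
  define g where "g = gcd u v"
  have g: "g \<noteq> 0"
    using uv by (simp add: g_def)
  have "of_int (u div g) * of_int g = (of_int u :: rat)" "of_int (v div g) * of_int g
      = (of_int v :: rat)"
    unfolding of_int_mult[symmetric] by (simp_all add: g_def)
  then have "of_int (b1 * b0) / of_int g * x = of_int (u div g)" "of_int (b1 * b0) / of_int g * y
      = of_int (v div g)"
    using g x y by (simp_all add: field_simps)
  moreover have "coprime (u div g) (v div g)"
    unfolding g_def using uv by (intro div_gcd_coprime) auto
  moreover have "of_int (b1 * b0) / of_int g \<noteq> (0::rat)"
    using g pos by simp
  ultimately show ?thesis by (rule that[rotated 1])
qed

section \<open>Reduction of sequences modulo p\<close>

locale laxton = prime_localization p for p +
  fixes P Q :: int
  assumes Q_not_dvd: "\<not> int p dvd Q"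

sublocale laxton \<subseteq> QQ: recurrence rat_ring "of_int P" "of_int Q"
proof -
  interpret cring rat_ring by (rule cring_from_type_algebra)
  show "recurrence rat_ring (of_int P) (of_int Q)"
    using Q_not_dvd by unfold_locales auto
qed

sublocale laxton \<subseteq> FF: recurrence "residue_ring (int p)" "P mod int p" "Q mod int p"
proof -
  show "recurrence (residue_ring (int p)) (P mod int p) (Q mod int p)"
    using Q_not_dvd F.m_gt_one
    by (intro recurrence.intro F.cring recurrence_axioms.intro F.mod_in_carrier F.mod_in_res_units)
      (simp_all add: F.p_coprime_right_int)
qed

context laxton
begin

abbreviation "Fp \<equiv> residue_ring (int p)"

lemma Zp_inverse_Q: "of_int Q \<noteq> (0::rat)" "inverse (of_int Q) \<in> Zp"
  using Zp_inverse[of "of_int Q"] Q_not_dvd by (auto simp: I_of_int)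

lemma rec_Q_up: "w \<in> QQ.RS \<Longrightarrow> w (n + 2) = of_int P * w (n + 1) - of_int Q * w n"
  using QQ.rec_up[of w n] by simp

lemma rec_Q_down: "w \<in> QQ.RS \<Longrightarrow> w n = inverse (of_int Q) * (of_int P * w (n + 1) - w (n + 2))"
  using rec_Q_up[of w n] Zp_inverse_Q(1) by (simp add: field_simps)

lemma I_mult: "x \<in> Zp \<Longrightarrow> y \<in> I \<Longrightarrow> x * y \<in> I" "y \<in> I \<Longrightarrow> x \<in> Zp \<Longrightarrow> y * x \<in> I"
  by (simp_all add: I_mult_iff I_sub_Zp)

section \<open>Sequences over Z_(p) and their reductions\<close>

definition "local_seqs = {w \<in> QQ.RS. w 0 \<in> Zp \<and> w 1 \<in> Zp}"

lemma local_seqs_Zp: "w \<in> local_seqs \<Longrightarrow> w n \<in> Zp"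
proof -
  assume w: "w \<in> local_seqs"
  then have RS: "w \<in> QQ.RS" by (simp add: local_seqs_def)
  show ?thesis
  proof (induction n rule: int_pair_induct)
    case (up n)
    then show ?case
      unfolding rec_Q_up[OF RS] by simp
  next
    case (down n)
    then show ?case
      unfolding rec_Q_down[OF RS, of n] by (simp add: Zp_inverse_Q)
  qed (use w in \<open>simp_all add: local_seqs_def\<close>)
qed

lemma local_seqs_RS: "w \<in> local_seqs \<Longrightarrow> w \<in> QQ.RS"
  by (simp add: local_seqs_def)

lemma rec_ideal_0:
  assumes RS: "w \<in> QQ.RS" and "w 0 \<in> I" "w 1 \<in> I"
  shows "w n \<in> I"
proof (induction n rule: int_pair_induct)
  case (up n)
  then show ?case
    unfolding rec_Q_up[OF RS] by (simp add: I_mult)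
next
  case (down n)
  then show ?case
    unfolding rec_Q_down[OF RS, of n] by (simp add: I_mult Zp_inverse_Q)
qed (use assms in auto)

lemma QQ_scale_shift: "w \<in> QQ.RS \<Longrightarrow> (\<lambda>n. c * w (n + m)) \<in> QQ.RS"
  using QQ.rec_seqs_scale[OF QQ.rec_seqs_shift[of w m], of c] by simp

lemma QQ_carrier_scale_shift: "w \<in> carrier QQ.SG \<Longrightarrow> c \<noteq> 0 \<Longrightarrow> (\<lambda>n. c * w (n + m)) \<in> carrier QQ.SG"
  using QQ.carrier_scale_shift[of w c m] by simp

lemma rec_ideal:
  assumes RS: "w \<in> QQ.RS" and "w m \<in> I" "w (m + 1) \<in> I"
  shows "w n \<in> I"
  using rec_ideal_0[OF QQ.rec_seqs_shift[OF RS, of m], of "n - m"] assms by (simp add: add.commute)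

lemma local_seqs_scale_shift: "w \<in> local_seqs \<Longrightarrow> c \<in> Zp \<Longrightarrow> (\<lambda>n. c * w (n + m)) \<in> local_seqs"
  using local_seqs_Zp[of w m] local_seqs_Zp[of w "1 + m"] QQ_scale_shift[OF local_seqs_RS, of w c m]
  unfolding local_seqs_def mem_Collect_eq by simp

definition "red_seq w = (\<lambda>n::int. rd (w n))"

lemma red_seq_RS: "w \<in> local_seqs \<Longrightarrow> red_seq w \<in> FF.RS"
proof (rule FF.rec_seqsI)
  assume w: "w \<in> local_seqs"
  show "red_seq w n \<in> carrier Fp" for n
    using local_seqs_Zp[OF w] by (simp add: red_seq_def)
  show "red_seq w (n + 2)
      = (P mod int p) \<otimes>\<^bsub>Fp\<^esub> red_seq w (n + 1) \<ominus>\<^bsub>Fp\<^esub> (Q mod int p) \<otimes>\<^bsub>Fp\<^esub> red_seq w n" for n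
    unfolding red_seq_def rec_Q_up[OF local_seqs_RS[OF w]] using local_seqs_Zp[OF w]
    by (simp add: rd_diff rd_mult rd_of_int)
qed

lemma red_seq_scale_shift:
  "w \<in> local_seqs \<Longrightarrow> c \<in> Zp \<Longrightarrow> red_seq (\<lambda>n. c * w (n + m)) = (\<lambda>n. rd c \<otimes>\<^bsub>Fp\<^esub> red_seq w (n + m))"
  by (simp add: red_seq_def rd_mult local_seqs_Zp)

lemma mult_local_seqs:
  assumes "w \<in> local_seqs" "v \<in> local_seqs"
  shows "w \<otimes>\<^bsub>QQ.SG\<^esub> v \<in> local_seqs"
  using assms local_seqs_Zp[OF assms(1)] local_seqs_Zp[OF assms(2)]
  by (simp add: local_seqs_def QQ.mult_1 QQ.mult_0)

lemma red_seq_mult: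
  assumes "w \<in> local_seqs" "v \<in> local_seqs"
  shows "red_seq (w \<otimes>\<^bsub>QQ.SG\<^esub> v) = red_seq w \<otimes>\<^bsub>FF.SG\<^esub> red_seq v"
proof (rule FF.rec_seqs_eqI)
  note RS = local_seqs_RS[OF assms(1)] local_seqs_RS[OF assms(2)] and FRS =
      red_seq_RS[OF assms(1)] red_seq_RS[OF assms(2)]
  note Z = local_seqs_Zp[OF assms(1)] local_seqs_Zp[OF assms(2)]
  show "red_seq (w \<otimes>\<^bsub>QQ.SG\<^esub> v) \<in> FF.RS"
    by (intro red_seq_RS mult_local_seqs assms)
  show "red_seq w \<otimes>\<^bsub>FF.SG\<^esub> red_seq v \<in> FF.RS"
    by (intro FF.mult_closed FRS)
  show "red_seq (w \<otimes>\<^bsub>QQ.SG\<^esub> v) 1 = (red_seq w \<otimes>\<^bsub>FF.SG\<^esub> red_seq v) 1"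
    unfolding FF.mult_1[OF FRS] unfolding red_seq_def QQ.mult_1[OF RS]
    using Z by (simp add: rd_diff rd_mult rd_of_int)
  show "red_seq (w \<otimes>\<^bsub>QQ.SG\<^esub> v) 0 = (red_seq w \<otimes>\<^bsub>FF.SG\<^esub> red_seq v) 0"
    unfolding FF.mult_0[OF FRS] unfolding red_seq_def QQ.mult_0[OF RS]
    using Z by (simp add: rd_diff rd_add rd_mult rd_of_int)
qed

lemma rd_Lam:
  assumes "x \<in> Zp" "y \<in> Zp"
  shows "QQ.Nm x y \<in> Zp" "rd (QQ.Nm x y) = FF.Nm (rd x) (rd y)"
  using assms
  by (simp_all add: QQ.Lam_eq F.Lam_eq rd_diff rd_add rd_mult rd_of_int)

text \<open>\<Lambda> has integer coefficients and so commutes with reduction; in the field F_p a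
  residue is a unit exactly when it comes from outside I.\<close>

lemma red_seq_carrier_iff:
  assumes "w \<in> local_seqs"
  shows "red_seq w \<in> carrier FF.SG \<longleftrightarrow> QQ.Nm (w 1) (w 0) \<notin> I"
  using red_seq_RS[OF assms] rd_Lam[of "w 1" "w 0"] local_seqs_Zp[OF assms] rd_Units_iff[of
      "QQ.Nm (w 1) (w 0)"]
  by (simp add: FF.carrier_seq_group red_seq_def)

lemma one_local_seqs: "\<one>\<^bsub>QQ.SG\<^esub> \<in> local_seqs"
  using QQ.one_rec by (simp add: local_seqs_def)

lemma red_seq_one: "red_seq \<one>\<^bsub>QQ.SG\<^esub> = \<one>\<^bsub>FF.SG\<^esub>"
  using QQ.one_rec(2,3)
  by (intro FF.rec_seqs_eqI red_seq_RS one_local_seqs FF.one_rec) (simp_all add: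
      red_seq_def F.res_one_eq F.res_zero_eq)

text \<open>\<open>local_units\<close> is \<open>\<S>(f, \<int>\<^sub>(\<^sub>p\<^sub>))\<^sup>\<times>\<close>: the condition on the reduction says that
  \<open>\<Lambda>(w\<^sub>1, w\<^sub>0)\<close> is a unit of \<open>\<int>\<^sub>(\<^sub>p\<^sub>)\<close>.\<close>

definition "local_units = {w \<in> local_seqs. w \<in> carrier QQ.SG \<and> red_seq w \<in> carrier FF.SG}"
definition "local_kernel = {w \<in> local_units. w 0 \<in> I}"

lemma local_units_local_seqs: "w \<in> local_units \<Longrightarrow> w \<in> local_seqs" and local_units_carrier: "w
    \<in> local_units \<Longrightarrow> w \<in> carrier QQ.SG"
  and local_units_rds: "w \<in> local_units \<Longrightarrow> red_seq w \<in> carrier FF.SG"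
  by (simp_all add: local_units_def)

text \<open>The norm is a unit of Z_(p), so conjugate divided by norm stays p-integral. The formula
  for the term at 0 lets the subgroup \<open>local_kernel\<close> inherit closure under
  inverses.\<close>

lemma local_units_inv:
  assumes w: "w \<in> local_units"
  defines "N \<equiv> QQ.Nm (w 1) (w 0)"
  shows "inv\<^bsub>QQ.SG\<^esub> w \<in> local_units" "(inv\<^bsub>QQ.SG\<^esub> w) 0 = inverse N * - w 0" "inverse N \<in> Zp"
proof -
  note wl = local_units_local_seqs[OF w] and wc = local_units_carrier[OF w]
  have N: "N \<in> Zp" "N \<notin> I"
    using rd_Lam(1)[OF local_seqs_Zp[OF wl] local_seqs_Zp[OF wl]]
        red_seq_carrier_iff[OF wl] local_units_rds[OF w]
    by (simp_all add: N_def)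
  note Ni = Zp_inverse[OF N]
  show "inverse N \<in> Zp" by (rule Ni)
  let ?y = "inv\<^bsub>QQ.SG\<^esub> w"
  have y: "?y n = inverse N * QQ.conj_seq w n" for n
    unfolding QQ.inv_seq[OF wc] using Ni(3) by (simp add: N_def)
  have y0: "?y 0 = inverse N * - w 0" and y1: "?y 1 = inverse N * (w 1 - of_int P * w 0)"
    unfolding y QQ.conj_seq[OF local_seqs_RS[OF wl]] by simp_all
  show "?y 0 = inverse N * - w 0" by (rule y0)
  have yc: "?y \<in> carrier QQ.SG"
    using wc by simp
  then have yl: "?y \<in> local_seqs"
    unfolding local_seqs_def mem_Collect_eq y0 y1
    using QQ.carrier_sub_RS local_seqs_Zp[OF wl] Ni by auto
  have "?y \<otimes>\<^bsub>QQ.SG\<^esub> w = \<one>\<^bsub>QQ.SG\<^esub>"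
    using wc by simp
  then have "red_seq ?y \<otimes>\<^bsub>FF.SG\<^esub> red_seq w = \<one>\<^bsub>FF.SG\<^esub>"
    using red_seq_mult[OF yl wl] red_seq_one by simp
  then have "QQ.Nm (?y 1) (?y 0) * N = 1"
    using QQ.Lam_mult[of ?y w] \<open>?y \<otimes>\<^bsub>QQ.SG\<^esub> w
        = _\<close> local_seqs_RS[OF yl] local_seqs_RS[OF wl] QQ.Lam_one
    by (simp add: N_def QQ.one_rec[simplified])
  \<comment> \<open>Otherwise 1, its product with N, would lie in I.\<close>
  then have "QQ.Nm (?y 1) (?y 0) \<notin> I"
    using I_mult(2)[of _ N] N I_1 by metis
  then have "red_seq ?y \<in> carrier FF.SG"
    using red_seq_carrier_iff[OF yl] by simp
  then show "?y \<in> local_units"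
    using yl yc by (simp add: local_units_def)
qed

lemma local_units_subgroup: "subgroup local_units QQ.SG"
proof (rule QQ.SG.subgroupI)
  show "local_units \<subseteq> carrier QQ.SG"
    by (auto simp: local_units_def)
  have "\<one>\<^bsub>QQ.SG\<^esub> \<in> local_units"
    by (simp add: local_units_def one_local_seqs red_seq_one)
  then show "local_units \<noteq> {}" by blast
  show "w \<otimes>\<^bsub>QQ.SG\<^esub> v \<in> local_units" if "w \<in> local_units" "v \<in> local_units" for w v
    using that by (simp add: local_units_def mult_local_seqs red_seq_mult)
qed (rule local_units_inv)

lemma local_kernel_subgroup: "subgroup local_kernel QQ.SG"
proof (rule QQ.SG.subgroupI)
  show "local_kernel \<subseteq> carrier QQ.SG"
    by (auto simp: local_units_def local_kernel_def)
  have "\<one>\<^bsub>QQ.SG\<^esub> \<in> local_kernel"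
    using subgroup.one_closed[OF local_units_subgroup] QQ.one_rec(3) by (simp add: local_kernel_def)
  then show "local_kernel \<noteq> {}" by blast
  show "w \<otimes>\<^bsub>QQ.SG\<^esub> v \<in> local_kernel" if "w \<in> local_kernel" "v \<in> local_kernel" for w v
  proof -
    have *: "w \<in> local_units" "v \<in> local_units" "w 0 \<in> I" "v 0 \<in> I"
      using that by (simp_all add: local_kernel_def)
    then have "(w \<otimes>\<^bsub>QQ.SG\<^esub> v) 0 \<in> I"
      unfolding QQ.mult_0[OF local_seqs_RS[OF local_units_local_seqs] local_seqs_RS[OF
          local_units_local_seqs], OF *(1,2)]
      using local_seqs_Zp[OF local_units_local_seqs, OF *(1)] local_seqs_Zp[OF
          local_units_local_seqs, OF *(2)] by (simp add: I_mult)
    then show ?thesis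
      using subgroup.m_closed[OF local_units_subgroup *(1,2)] by (simp add: local_kernel_def)
  qed
  show "inv\<^bsub>QQ.SG\<^esub> w \<in> local_kernel" if "w \<in> local_kernel" for w
  proof -
    have *: "w \<in> local_units" "w 0 \<in> I"
      using that by (simp_all add: local_kernel_def)
    then show ?thesis
      using local_units_inv[OF *(1)] by (simp add: local_kernel_def I_mult)
  qed
qed

lemma red_seq_hom: "group_hom (QQ.SG\<lparr>carrier := local_units\<rparr>) FF.SG red_seq"
proof -
  interpret S: group "QQ.SG\<lparr>carrier := local_units\<rparr>"
    by (rule subgroup.subgroup_is_group[OF local_units_subgroup QQ.SG.group_axioms])
  show ?thesis
    by unfold_locales (auto simp: hom_def local_units_rds red_seq_mult local_units_local_seqs)
qed

lemma finite_FF: "finite (carrier FF.SG)"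
proof (rule inj_on_finite[of "\<lambda>w. (w 1, w 0)"])
  show "inj_on (\<lambda>w. (w 1, w 0)) (carrier FF.SG)"
    using FF.carrier_sub_RS by (auto intro!: inj_onI FF.rec_seqs_eqI)
  have "w n \<in> carrier Fp" if "w \<in> carrier FF.SG" for w n
    using that by (rule FF.rec_closed[OF subsetD[OF FF.carrier_sub_RS]])
  then show "(\<lambda>w. (w 1, w 0)) ` carrier FF.SG \<subseteq> carrier Fp \<times> carrier Fp"
    by blast
qed (auto intro: F.finite)

text \<open>Let N be the order of the finite group over F_p. By Lagrange the N-th power of w reduces
  to the Lucas sequence, whose term at 0 is 0.\<close>

lemma local_units_sub_radical: "local_units \<subseteq> radical QQ.SG local_kernel"
proof
  fix w assume w: "w \<in> local_units"
  interpret h: group_hom "QQ.SG\<lparr>carrier := local_units\<rparr>" FF.SG red_seq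
    by (rule red_seq_hom)
  define N where "N = Coset.order FF.SG"
  have N: "N > 0"
    unfolding N_def using finite_FF FF.SG.order_gt_0_iff_finite by simp
  have wN: "w [^]\<^bsub>QQ.SG\<^esub> N \<in> local_units"
    using h.G.nat_pow_closed[of w N] w by (simp flip: QQ.SG.nat_pow_consistent)
  have "red_seq (w [^]\<^bsub>QQ.SG\<^esub> N) = red_seq w [^]\<^bsub>FF.SG\<^esub> N"
    using h.hom_nat_pow[of w N] w by (simp flip: QQ.SG.nat_pow_consistent)
  also have "\<dots> = \<one>\<^bsub>FF.SG\<^esub>"
    unfolding N_def using local_units_rds[OF w] by (rule FF.SG.pow_order_eq_1)
  finally have "rd ((w [^]\<^bsub>QQ.SG\<^esub> N) 0) = 0"
    by (metis red_seq_def FF.one_rec(3) F.res_zero_eq)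
  then have "w [^]\<^bsub>QQ.SG\<^esub> N \<in> local_kernel"
    using wN by (simp add: local_kernel_def rd_eq_0_iff local_seqs_Zp local_units_local_seqs)
  then have "w [^]\<^bsub>QQ.SG\<^esub> int N \<in> local_kernel"
    by (simp add: int_pow_int)
  then show "w \<in> radical QQ.SG local_kernel"
    using local_units_carrier[OF w] N unfolding radical_def by (auto intro!: exI[of _ "int N"])
qed


section \<open>Sequences primitive at p\<close>

definition "prim w \<longleftrightarrow> w \<in> local_seqs \<and> \<not> (w 0 \<in> I \<and> w 1 \<in> I)"

lemma prim_local_seqs: "prim w \<Longrightarrow> w \<in> local_seqs"
  by (simp add: prim_def)

lemma prim_consecutive: "prim w \<Longrightarrow> w m \<in> I \<Longrightarrow> w (m + 1) \<notin> I"
  using rec_ideal[OF local_seqs_RS[OF prim_local_seqs], of w m] unfolding prim_def by blast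

text \<open>Integrality of w from k on is all that a member of Laxton's group offers. Beyond that
  index some matching term of v is a unit of Z_(p), and c is a quotient of terms there.\<close>

lemma ratio_Zp:
  assumes v: "prim v" and w: "\<And>n. n \<ge> k \<Longrightarrow> w n \<in> Zp" and eq: "w = (\<lambda>n. c * v (n + m))"
  shows "c \<in> Zp"
proof -
  \<comment> \<open>Of the terms of v at k + m and k + m + 1, at least one lies outside I.\<close>
  obtain i where i: "i \<ge> k" "v (i + m) \<notin> I"
    using prim_consecutive[OF v, of "k + m"]
        by (metis add.assoc add.commute order_refl zle_add1_eq_le less_add_one less_imp_le)
  note inv = Zp_inverse[OF local_seqs_Zp[OF prim_local_seqs[OF v]] i(2)]
  have "w i * inverse (v (i + m)) = c"
    unfolding eq using inv(3) by simp
  then show ?thesis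
    using w[OF i(1)] inv(1) Zp_mult by metis
qed

text \<open>A scalar in I would put all terms of w into I, against primitivity.\<close>

lemma ratio_unit:
  assumes v: "prim v" and w: "prim w" and eq: "w = (\<lambda>n. c * v (n + m))"
  shows "c \<in> Zp" "c \<notin> I"
proof -
  show "c \<in> Zp"
    using local_seqs_Zp[OF prim_local_seqs[OF w]] by (rule ratio_Zp[OF v _ eq])
  show "c \<notin> I"
  proof
    assume "c \<in> I"
    then have "w n \<in> I" for n
      unfolding eq using local_seqs_Zp[OF prim_local_seqs[OF v]] by (simp add: I_mult)
    then show False
      using w by (simp add: prim_def)
  qed
qed

lemma local_units_prim: "w \<in> local_units \<Longrightarrow> prim w"
proof -
  assume w: "w \<in> local_units"
  note Z = local_seqs_Zp[OF local_units_local_seqs[OF w]]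
  have "QQ.Nm (w 1) (w 0) \<in> I" if "w 0 \<in> I" "w 1 \<in> I"
    using that Z by (simp add: QQ.Lam_eq I_mult)
  then show ?thesis
    using red_seq_carrier_iff[OF local_units_local_seqs[OF w]] local_units_rds[OF w]
        local_units_local_seqs[OF w] by (auto simp: prim_def)
qed

lemma local_units_scale_shift:
  assumes w: "w \<in> local_units" and c: "c \<in> Zp" "c \<notin> I"
  shows "(\<lambda>n. c * w (n + m)) \<in> local_units" "FF.scls (red_seq (\<lambda>n. c * w (n + m)))
      = FF.scls (red_seq w)"
proof -
  let ?w = "\<lambda>n. c * w (n + m)"
  have u: "rd c \<in> Units Fp"
    using c by (simp add: rd_Units_iff)
  have eq: "red_seq ?w = (\<lambda>n. rd c \<otimes>\<^bsub>Fp\<^esub> red_seq w (n + m))"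
    by (rule red_seq_scale_shift[OF local_units_local_seqs[OF w] c(1)])
  then have car: "red_seq ?w \<in> carrier FF.SG"
    using FF.carrier_scale_shift[OF local_units_rds[OF w] u] by simp
  then show "?w \<in> local_units"
    using local_seqs_scale_shift[OF local_units_local_seqs[OF w] c(1)] QQ_carrier_scale_shift[OF
        local_units_carrier[OF w]] Zp_inverse(3)[OF c]
    by (simp add: local_units_def)
  show "FF.scls (red_seq ?w) = FF.scls (red_seq w)"
    using FF.scls_eq_iff[OF car local_units_rds[OF w]] u eq by blast
qed

lemma QQ_scls_eq_iff:
  assumes "w \<in> carrier QQ.SG" "v \<in> carrier QQ.SG"
  shows "QQ.scls w = QQ.scls v \<longleftrightarrow> (\<exists>c m. c \<noteq> 0 \<and> w = (\<lambda>n. c * v (n + m)))"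
  using QQ.scls_eq_iff[OF assms] by auto

lemma QQ_cls_eq_iff:
  assumes "w \<in> carrier QQ.SG" "v \<in> carrier QQ.SG"
  shows "QQ.cls w = QQ.cls v \<longleftrightarrow> (\<exists>c. c \<noteq> 0 \<and> w = (\<lambda>n. c * v n))"
  using QQ.cls_eq_iff[OF assms] by auto

lemma cls_imp_scls:
  assumes "w \<in> carrier QQ.SG" "v \<in> carrier QQ.SG" "QQ.cls w = QQ.cls v"
  shows "QQ.scls w = QQ.scls v"
proof -
  obtain c where "c \<noteq> 0" "w = (\<lambda>n. c * v (n + 0))"
    using assms QQ_cls_eq_iff[OF assms(1,2)] by auto
  then show ?thesis
    using QQ_scls_eq_iff[OF assms(1,2)] by blast
qed

text \<open>This makes reduction well defined on classes over the rationals: the scalar relating two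
  members could be any rational, but primitivity on both sides makes it a unit of Z_(p).\<close>

lemma local_units_transfer:
  assumes s: "s \<in> local_units" and w: "prim w" "w \<in> carrier QQ.SG" "QQ.scls w = QQ.scls s"
  shows "w \<in> local_units" "FF.scls (red_seq w) = FF.scls (red_seq s)"
proof -
  obtain c m where c: "w = (\<lambda>n. c * s (n + m))"
    using w(3) QQ_scls_eq_iff[OF w(2) local_units_carrier[OF s]] by blast
  note u = ratio_unit[OF local_units_prim[OF s] w(1) c]
  show "w \<in> local_units" "FF.scls (red_seq w) = FF.scls (red_seq s)"
    using local_units_scale_shift[OF s u, of m] c by simp_all
qed

lemma carrier_nonzero: "w \<in> carrier QQ.SG \<Longrightarrow> w 1 \<noteq> 0 \<or> w 0 \<noteq> 0"
  by (auto simp: QQ.carrier_seq_group QQ.Lam_eq)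

lemma coprime_rep:
  assumes w: "w \<in> carrier QQ.SG"
  obtains v a b where "v \<in> carrier QQ.SG" "QQ.cls v = QQ.cls w" "coprime_init v a b"
proof -
  obtain c a b where c: "c \<noteq> 0" "c * w 1 = of_int a" "c * w 0 = of_int b" "coprime a b"
    using carrier_nonzero[OF w] by (rule rat_pair_coprime)
  let ?v = "\<lambda>n. c * w n"
  have v: "?v \<in> carrier QQ.SG"
    using QQ_carrier_scale_shift[OF w c(1), of 0] by simp
  moreover have "QQ.cls ?v = QQ.cls w"
    using QQ_cls_eq_iff[OF v w] c(1) by blast
  moreover have "coprime_init ?v a b"
    using c by (simp add: coprime_init_def)
  ultimately show ?thesis by (rule that)
qed

section \<open>Reduction to the projective line\<close>

lemma coprime_init_prim:
  assumes "w \<in> QQ.RS" "coprime_init w a b"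
  shows "prim w" "red_seq w 1 = a mod int p" "red_seq w 0 = b mod int p"
proof -
  have ab: "w 1 = of_int a" "w 0 = of_int b" "coprime a b"
    using assms by (auto simp: coprime_init_def)
  have "\<not> (int p dvd a \<and> int p dvd b)"
    using ab(3) prime_int_p not_coprimeI not_prime_unit by blast
  then show "prim w"
    using assms(1) ab by (auto simp: prim_def local_seqs_def I_of_int)
  show "red_seq w 1 = a mod int p" "red_seq w 0 = b mod int p"
    by (simp_all add: red_seq_def ab rd_of_int)
qed

lemma carrier_RS: "w \<in> carrier QQ.SG \<Longrightarrow> w \<in> QQ.RS"
  using QQ.carrier_sub_RS by blast

lemma proj_pt_prim_scale:
  assumes v: "prim v" "v \<in> carrier QQ.SG" and w: "prim w" "w \<in> carrier QQ.SG" and eq: "QQ.cls w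
      = QQ.cls v"
  shows "proj_pt Fp (red_seq w 1) (red_seq w 0) = proj_pt Fp (red_seq v 1) (red_seq v 0)"
proof -
  obtain c where c: "w = (\<lambda>n. c * v (n + 0))"
    using eq QQ_cls_eq_iff[OF w(2) v(2)] by auto
  note u = ratio_unit[OF v(1) w(1) c]
  have "red_seq w = (\<lambda>n. rd c \<otimes>\<^bsub>Fp\<^esub> red_seq v (n + 0))"
    unfolding c by (rule red_seq_scale_shift[OF prim_local_seqs[OF v(1)] u(1)])
  moreover have "red_seq v n \<in> carrier Fp" for n
    by (rule FF.rec_closed[OF red_seq_RS[OF prim_local_seqs[OF v(1)]]])
  ultimately show ?thesis
    using proj_pt_scale[OF F.cring, of "rd c" "red_seq v 1" "red_seq v 0"] u by
        (simp add: rd_Units_iff)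
qed

text \<open>The definition speaks of coprime integral members only. Any primitive member serves as
  well, since the two differ by a unit of Z_(p), which cancels in the projective line.\<close>

lemma red_proj_prim:
  assumes s: "prim s" "s \<in> carrier QQ.SG"
  shows "red_proj p (QQ.cls s) = proj_pt Fp (red_seq s 1) (red_seq s 0)"
  unfolding red_proj_def
proof (rule the_equality)
  have *: "proj_pt Fp (a mod int p) (b mod int p) = proj_pt Fp (red_seq s 1) (red_seq s 0)"
    if v: "v \<in> QQ.cls s" "coprime_init v a b" for v a b
  proof -
    have vc: "v \<in> carrier QQ.SG" "QQ.cls v = QQ.cls s"
      using v(1) QQ.mem_cls_iff[OF s(2)] by auto
    note cop = coprime_init_prim[OF carrier_RS[OF vc(1)] v(2)]
    show ?thesis
      using proj_pt_prim_scale[OF s cop(1) vc] cop(2,3) by simp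
  qed
  obtain v a b where v: "v \<in> carrier QQ.SG" "QQ.cls v = QQ.cls s" "coprime_init v a b"
    using coprime_rep[OF s(2)] .
  then have "v \<in> QQ.cls s"
    using QQ.mem_cls_iff[OF s(2)] by auto
  then show "\<exists>w\<in>QQ.cls s. \<exists>a b. coprime_init w a b \<and> proj_pt Fp (red_seq s 1) (red_seq s 0)
      = proj_pt Fp (a mod int p) (b mod int p)"
    using v(3) * by metis
  show "c = proj_pt Fp (red_seq s 1) (red_seq s 0)"
    if "\<exists>w\<in>QQ.cls s. \<exists>a b. coprime_init w a b \<and> c = proj_pt Fp (a mod int p) (b mod int p)" for c
    using that * by metis
qed

lemma prim_rep:
  assumes "A \<in> carrier (GQ P Q)"
  obtains w where "prim w" "w \<in> carrier QQ.SG" "A = QQ.cls w"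
proof -
  obtain u where u: "u \<in> carrier QQ.SG" "A = QQ.cls u"
    using assms unfolding QQ.G_quot(3) by blast
  obtain v a b where v: "v \<in> carrier QQ.SG" "QQ.cls v = QQ.cls u" "coprime_init v a b"
    using coprime_rep[OF u(1)] .
  then show ?thesis
    using that[OF coprime_init_prim(1)[OF carrier_RS[OF v(1)] v(3)] v(1)] u(2) by simp
qed

lemma GQ_cls: "w \<in> carrier QQ.SG \<Longrightarrow> QQ.cls w \<in> carrier (GQ P Q)"
  unfolding QQ.G_quot(3) by (rule imageI)

text \<open>Two solutions proportional at 1 and 0 are proportional everywhere, so the reduction
  inherits a unit norm from u.\<close>

lemma red_seq_carrier_if_proportional:
  assumes w: "w \<in> local_seqs" and u: "u \<in> carrier FF.SG" and "(red_seq w 1, red_seq w 0)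
      \<in> proj_pt Fp (u 1) (u 0)"
  shows "red_seq w \<in> carrier FF.SG"
proof -
  obtain c where c: "c \<in> Units Fp" "red_seq w 1 = c \<otimes>\<^bsub>Fp\<^esub> u 1" "red_seq w 0 = c \<otimes>\<^bsub>Fp\<^esub> u 0"
    using assms(3) by (auto simp: proj_pt_def)
  have v: "(\<lambda>n. c \<otimes>\<^bsub>Fp\<^esub> u (n + 0)) \<in> carrier FF.SG"
    by (rule FF.carrier_scale_shift[OF u c(1)])
  have "red_seq w = (\<lambda>n. c \<otimes>\<^bsub>Fp\<^esub> u (n + 0))"
    using c(2,3) by (intro FF.rec_seqs_eqI
        red_seq_RS[OF w] subsetD[OF FF.carrier_sub_RS v]) simp_all
  then show ?thesis
    using v by simp
qed

lemma self_mem_proj_pt: "w \<in> local_seqs \<Longrightarrow> (red_seq w 1, red_seq w 0)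
    \<in> proj_pt Fp (red_seq w 1) (red_seq w 0)"
proof -
  assume "w \<in> local_seqs"
  then have "red_seq w n = \<one>\<^bsub>Fp\<^esub> \<otimes>\<^bsub>Fp\<^esub> red_seq w n" for n
    using FF.rec_closed[OF red_seq_RS] F.l_one by simp
  then show ?thesis
    using F.Units_one_closed unfolding proj_pt_def by blast
qed

lemma proj_pt_one: "proj_pt Fp 1 0 = proj_pt Fp (\<one>\<^bsub>FF.SG\<^esub> 1) (\<one>\<^bsub>FF.SG\<^esub> 0)"
  unfolding FF.one_rec by (simp add: F.res_one_eq F.res_zero_eq)

text \<open>[1:0] is the point of the Lucas sequence, the unit of the group over F_p. A primitive
  sequence reducing to it therefore has norm outside I.\<close>

lemma G_p_eq: "G_p P Q p = QQ.cls ` local_kernel"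
proof (intro equalityI subsetI)
  fix A assume "A \<in> G_p P Q p"
  then have A: "A \<in> carrier (GQ P Q)" "red_proj p A = proj_pt Fp 1 0"
    by (simp_all add: G_p_def)
  obtain w where w: "prim w" "w \<in> carrier QQ.SG" "A = QQ.cls w"
    using A(1) by (rule prim_rep)
  note wl = prim_local_seqs[OF w(1)]
  have mem: "(red_seq w 1, red_seq w 0) \<in> proj_pt Fp 1 0"
    using self_mem_proj_pt[OF wl] A(2) red_proj_prim[OF w(1,2)] w(3) by simp
  then have "red_seq w \<in> carrier FF.SG"
    unfolding proj_pt_one by (intro red_seq_carrier_if_proportional[OF wl FF.SG.one_closed])
  moreover have "red_seq w 0 = 0"
    using mem by (auto simp: proj_pt_def F.res_mult_eq)
  then have "w 0 \<in> I"
    using rd_eq_0_iff[OF local_seqs_Zp[OF wl]] by (simp add: red_seq_def)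
  ultimately have "w \<in> local_kernel"
    using wl w(2) by (simp add: local_kernel_def local_units_def)
  then show "A \<in> QQ.cls ` local_kernel"
    using w(3) by blast
next
  fix A assume "A \<in> QQ.cls ` local_kernel"
  then obtain s where s: "s \<in> local_kernel" "A = QQ.cls s" by blast
  then have sS: "s \<in> local_units" and s0: "s 0 \<in> I"
    by (simp_all add: local_kernel_def)
  note sp = local_units_prim[OF sS] and sc = local_units_carrier[OF sS]
  note Z = local_seqs_Zp[OF prim_local_seqs[OF sp]]
  have "red_seq s 0 = 0"
    using rd_eq_0_iff[OF Z] s0 by (simp add: red_seq_def)
  \<comment> \<open>With \<open>s 0\<close> in I, primitivity leaves the term at 1 as a unit, and
    (u, 0) is u times (1, 0).\<close>
  moreover have u: "red_seq s 1 \<in> Units Fp"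
    using sp s0 rd_Units_iff[OF Z] by (simp add: prim_def red_seq_def)
  ultimately have "proj_pt Fp (red_seq s 1) (red_seq s 0) = proj_pt Fp 1 0"
    using proj_pt_scale[OF F.cring u F.one_closed F.zero_closed]
    unfolding F.r_one[OF F.Units_closed[OF u]] F.r_null[OF F.Units_closed[OF u]]
    by (simp add: F.res_one_eq F.res_zero_eq)
  then show "A \<in> G_p P Q p"
    using red_proj_prim[OF sp sc] s(2) GQ_cls[OF sc] by (simp add: G_p_def)
qed

lemma to_proj_cls:
  assumes u: "u \<in> carrier FF.SG"
  shows "to_proj (FF.cls u) = proj_pt Fp (u 1) (u 0)"
proof (intro equalityI subsetI)
  fix z assume "z \<in> to_proj (FF.cls u)"
  then obtain v where v: "v \<in> FF.cls u" "z = (v 1, v 0)"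
    by (auto simp: to_proj_def)
  then have "v \<in> carrier FF.SG" "FF.cls v = FF.cls u"
    using FF.mem_cls_iff[OF u] by auto
  then obtain c where "c \<in> Units Fp" "v = (\<lambda>n. c \<otimes>\<^bsub>Fp\<^esub> u n)"
    using FF.cls_eq_iff[OF _ u] by blast
  then show "z \<in> proj_pt Fp (u 1) (u 0)"
    using v(2) by (auto simp: proj_pt_def)
next
  fix z assume "z \<in> proj_pt Fp (u 1) (u 0)"
  then obtain c where c: "c \<in> Units Fp" "z = (c \<otimes>\<^bsub>Fp\<^esub> u 1, c \<otimes>\<^bsub>Fp\<^esub> u 0)"
    by (auto simp: proj_pt_def)
  let ?v = "\<lambda>n. c \<otimes>\<^bsub>Fp\<^esub> u n"
  have v: "?v \<in> carrier FF.SG"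
    using FF.carrier_scale_shift[OF u c(1), of 0] by simp
  then have "?v \<in> FF.cls u"
    using FF.cls_eq_iff[OF v u] FF.mem_cls_iff[OF u] c(1) by blast
  then show "z \<in> to_proj (FF.cls u)"
    unfolding to_proj_def c(2) by (rule rev_image_eqI) simp
qed

lemma K_p_eq: "K_p P Q p = QQ.cls ` local_units"
proof (intro equalityI subsetI)
  fix A assume "A \<in> K_p P Q p"
  then have A: "A \<in> carrier (GQ P Q)" "red_proj p A \<in> to_proj ` carrier (GF P Q p)"
    by (simp_all add: K_p_def)
  obtain w where w: "prim w" "w \<in> carrier QQ.SG" "A = QQ.cls w"
    using A(1) by (rule prim_rep)
  note wl = prim_local_seqs[OF w(1)]
  obtain u where u: "u \<in> carrier FF.SG" "red_proj p A = to_proj (FF.cls u)"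
    using A(2) unfolding FF.G_quot(3) by blast
  have "(red_seq w 1, red_seq w 0) \<in> proj_pt Fp (u 1) (u 0)"
    using self_mem_proj_pt[OF wl] u(2) red_proj_prim[OF w(1,2)] w(3) to_proj_cls[OF u(1)] by simp
  then have "w \<in> local_units"
    using red_seq_carrier_if_proportional[OF wl u(1)] wl w(2) by (simp add: local_units_def)
  then show "A \<in> QQ.cls ` local_units"
    using w(3) by blast
next
  fix A assume "A \<in> QQ.cls ` local_units"
  then obtain s where s: "s \<in> local_units" "A = QQ.cls s" by blast
  have "red_proj p A = to_proj (FF.cls (red_seq s))"
    using red_proj_prim[OF local_units_prim[OF s(1)] local_units_carrier[OF s(1)]] to_proj_cls[OF
        local_units_rds[OF s(1)]] s(2) by simp
  moreover have "FF.cls (red_seq s) \<in> carrier (GF P Q p)"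
    unfolding FF.G_quot(3) using local_units_rds[OF s(1)] by (rule imageI)
  ultimately show "A \<in> K_p P Q p"
    using GQ_cls[OF local_units_carrier[OF s(1)]] s(2) by (simp add: K_p_def)
qed

section \<open>From scaling classes to shift classes\<close>

lemma to_GsQ_eq:
  assumes "w \<in> A" "\<And>v. v \<in> A \<Longrightarrow> QQ.scls v = QQ.scls w"
  shows "to_GsQ P Q A = QQ.scls w"
proof -
  have "to_GsQ P Q A = (\<Union>v\<in>A. QQ.scls v)"
    unfolding to_GsQ_def QQ.scls_def by (rule Image_eq_UN)
  also have "\<dots> = (\<Union>v\<in>A. QQ.scls w)"
    using assms(2) by (rule SUP_cong[OF refl])
  finally show ?thesis
    using assms(1) by blast
qed

lemma to_GsQ_cls:
  assumes w: "w \<in> carrier QQ.SG"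
  shows "to_GsQ P Q (QQ.cls w) = QQ.scls w"
proof (rule to_GsQ_eq)
  show "w \<in> QQ.cls w"
    using QQ.mem_cls_iff[OF w] w by blast
  show "QQ.scls v = QQ.scls w" if "v \<in> QQ.cls w" for v
    using that QQ.mem_cls_iff[OF w] cls_imp_scls[OF _ w] by blast
qed

lemma Gs_p_eq: "Gs_p P Q p = QQ.scls ` local_kernel"
proof -
  have "to_GsQ P Q (QQ.cls w) = QQ.scls w" if "w \<in> local_kernel" for w
    using that by (intro to_GsQ_cls) (simp add: local_kernel_def local_units_def)
  then show ?thesis
    unfolding Gs_p_def G_p_eq image_image by (rule image_cong[OF refl])
qed

lemma Ks_p_eq: "Ks_p P Q p = QQ.scls ` local_units"
proof -
  have "to_GsQ P Q (QQ.cls w) = QQ.scls w" if "w \<in> local_units" for w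
    using that by (intro to_GsQ_cls local_units_carrier)
  then show ?thesis
    unfolding Ks_p_def K_p_eq image_image by (rule image_cong[OF refl])
qed

sublocale cls: group_hom QQ.SG "GQ P Q" QQ.cls
  by (rule QQ.G_quot)

sublocale scls: group_hom QQ.SG "GsQ P Q" QQ.scls
  by (rule QQ.Gs_quot)

lemma Gs_p_subgroup: "subgroup (Gs_p P Q p) (GsQ P Q)"
  unfolding Gs_p_eq by (rule scls.subgroup_img_is_subgroup[OF local_kernel_subgroup])

lemma Ks_p_subgroup: "subgroup (Ks_p P Q p) (GsQ P Q)"
  unfolding Ks_p_eq by (rule scls.subgroup_img_is_subgroup[OF local_units_subgroup])

lemma to_GsQ_hom: "group_hom (GQ P Q) (GsQ P Q) (to_GsQ P Q)"
proof -
  have "to_GsQ P Q \<in> hom (GQ P Q) (GsQ P Q)"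
  proof (rule homI)
    fix A B assume "A \<in> carrier (GQ P Q)" "B \<in> carrier (GQ P Q)"
    then obtain w v where w: "w \<in> carrier QQ.SG" "A = QQ.cls w" and v: "v \<in> carrier QQ.SG" "B
        = QQ.cls v"
      unfolding QQ.G_quot(3) by blast
    then show "to_GsQ P Q A \<in> carrier (GsQ P Q)"
      by (simp add: to_GsQ_cls)
    have "A \<otimes>\<^bsub>GQ P Q\<^esub> B = QQ.cls (w \<otimes>\<^bsub>QQ.SG\<^esub> v)"
      using w v by simp
    then show "to_GsQ P Q (A \<otimes>\<^bsub>GQ P Q\<^esub> B) = to_GsQ P Q A \<otimes>\<^bsub>GsQ P Q\<^esub> to_GsQ P Q B"
      using to_GsQ_cls[OF QQ.SG.m_closed[OF w(1) v(1)]] scls.hom_mult[OF w(1) v(1)] w v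
      by (simp only: to_GsQ_cls)
  qed
  then show ?thesis
    by (intro group_hom.intro group_hom_axioms.intro cls.H.group_axioms scls.H.group_axioms)
qed

lemma to_GsQ_surj: "to_GsQ P Q ` carrier (GQ P Q) = carrier (GsQ P Q)"
  unfolding QQ.G_quot(3) QQ.Gs_quot(3) image_image
  by (rule image_cong[OF refl to_GsQ_cls])

text \<open>Powers of A stay in the carrier, which is all that \<open>G_p\<close> asks beyond the
  condition in \<open>H_p\<close>.\<close>

lemma H_p_eq: "H_p P Q p = radical (GQ P Q) (G_p P Q p)"
  unfolding H_p_def G_p_def radical_def using cls.H.int_pow_closed by blast

lemma G_p_subgroup: "subgroup (G_p P Q p) (GQ P Q)"
  unfolding G_p_eq by (rule cls.subgroup_img_is_subgroup[OF local_kernel_subgroup])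

lemma one_local_units: "\<one>\<^bsub>QQ.SG\<^esub> \<in> local_units"
  by (rule subgroup.one_closed[OF local_units_subgroup])

text \<open>The kernel consists of the classes of the shifts of the Lucas sequence, and every element
  of \<open>local_units\<close> has finite order modulo \<open>p\<close>.\<close>

lemma kernel_to_GsQ: "kernel (GQ P Q) (GsQ P Q) (to_GsQ P Q) \<subseteq> radical (GQ P Q) (G_p P Q p)"
proof
  fix A assume "A \<in> kernel (GQ P Q) (GsQ P Q) (to_GsQ P Q)"
  then have A: "A \<in> carrier (GQ P Q)" "to_GsQ P Q A = \<one>\<^bsub>GsQ P Q\<^esub>"
    by (simp_all add: kernel_def)
  then obtain w where w: "w \<in> carrier QQ.SG" "A = QQ.cls w"
    unfolding QQ.G_quot(3) by blast
  then have "QQ.scls w = QQ.scls \<one>\<^bsub>QQ.SG\<^esub>"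
    using A(2) by (simp add: to_GsQ_cls)
  then obtain c m where c: "c \<noteq> 0" "w = (\<lambda>n. c * \<one>\<^bsub>QQ.SG\<^esub> (n + m))"
    using QQ_scls_eq_iff[OF w(1) QQ.SG.one_closed] by blast
  \<comment> \<open>The scalar c may involve p, but the class A does not see it. Without c the
    shifted Lucas sequence lies in \<open>local_units\<close>; the factor 1 only fits the scaling
    lemma.\<close>
  let ?t = "\<lambda>n. 1 * \<one>\<^bsub>QQ.SG\<^esub> (n + m)"
  have t: "?t \<in> local_units"
    by (rule local_units_scale_shift[OF one_local_units]) simp_all
  have At: "A = QQ.cls ?t"
    using QQ_cls_eq_iff[OF w(1) local_units_carrier[OF t]] w(2) c by auto
  obtain n :: int where n: "n \<noteq> 0" "?t [^]\<^bsub>QQ.SG\<^esub> n \<in> local_kernel"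
    using t local_units_sub_radical unfolding radical_def by blast
  have "A [^]\<^bsub>GQ P Q\<^esub> n = QQ.cls (?t [^]\<^bsub>QQ.SG\<^esub> n)"
    unfolding At by (rule cls.hom_int_pow[OF local_units_carrier[OF t], symmetric])
  then have "A [^]\<^bsub>GQ P Q\<^esub> n \<in> G_p P Q p"
    unfolding G_p_eq using n(2) by (rule image_eqI)
  then show "A \<in> radical (GQ P Q) (G_p P Q p)"
    using A(1) n(1) unfolding radical_def by blast
qed

text \<open>Gives the image of H a description inside \<open>GsQ P Q\<close> alone, the form that
  can be compared with Laxton's definition.\<close>

lemma Hs_p_eq: "Hs_p P Q p = radical (GsQ P Q) (Gs_p P Q p)"
  unfolding Hs_p_def H_p_eq Gs_p_def
  by (rule radical_image[OF to_GsQ_hom QQ.G_quot(1) to_GsQ_surj G_p_subgroup kernel_to_GsQ])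

lemma Hs_p_subgroup: "subgroup (Hs_p P Q p) (GsQ P Q)"
  unfolding Hs_p_eq by (rule comm_group.radical_subgroup[OF QQ.Gs_quot(1) Gs_p_subgroup])

section \<open>Laxton's group and the isomorphism with the rational group\<close>

abbreviation "L \<equiv> laxton_seqs P Q"
abbreviation "LG \<equiv> laxton_group P Q"

definition "lcls w = shift_rel rat_ring L `` {w}"

lemma L_iff: "w \<in> L \<longleftrightarrow> w \<in> carrier QQ.SG \<and> (\<exists>m. \<forall>k\<ge>m. w k \<in> \<int>)"
  by (auto simp: laxton_seqs_def QQ.carrier_seq_group)

lemma L_carrier: "w \<in> L \<Longrightarrow> w \<in> carrier QQ.SG"
  by (simp add: L_iff)

lemma L_RS: "L \<subseteq> QQ.RS"
  using L_carrier carrier_RS by blast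

text \<open>Integrality propagates only forwards: going backwards divides by Q, a unit of Z_(p) but
  perhaps not of the integers.\<close>

lemma rec_Ints:
  assumes w: "w \<in> QQ.RS" "w 0 \<in> \<int>" "w 1 \<in> \<int>" and "k \<ge> 0"
  shows "w k \<in> \<int>"
proof -
  have "w (int n) \<in> \<int> \<and> w (int n + 1) \<in> \<int>" for n
  proof (induction n)
    case (Suc n)
    then show ?case
      using rec_Q_up[OF w(1), of "int n"] by (simp add: add.commute)
  qed (use w in simp)
  from this[of "nat k"] show ?thesis
    using \<open>k \<ge> 0\<close> by simp
qed

lemma L_if_Ints:
  assumes "w \<in> carrier QQ.SG" "w 0 \<in> \<int>" "w 1 \<in> \<int>"
  shows "w \<in> L"
  using assms rec_Ints[OF carrier_RS] unfolding L_iff by blast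

text \<open>The product is defined from the terms at 0 and 1, which need not be integral. As it is
  compatible with shifts, both factors are first moved to where they are integral, and the product
  is moved back.\<close>

lemma L_mult:
  assumes w: "w \<in> L" and v: "v \<in> L"
  shows "w \<otimes>\<^bsub>QQ.SG\<^esub> v \<in> L"
proof -
  obtain m k where m: "\<And>i. i \<ge> m \<Longrightarrow> w i \<in> \<int>" and k: "\<And>i. i \<ge> k \<Longrightarrow> v i \<in> \<int>"
    using w v unfolding L_iff by blast
  note RS = subsetD[OF L_RS w] subsetD[OF L_RS v]
  let ?w = "\<lambda>n. 1 * w (n + m)" and ?v = "\<lambda>n. 1 * v (n + k)"
  have RS': "?w \<in> QQ.RS" "?v \<in> QQ.RS"
    using QQ_scale_shift[OF RS(1)] QQ_scale_shift[OF RS(2)] by blast+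
  have Z: "w m \<in> \<int>" "w (1 + m) \<in> \<int>" "v k \<in> \<int>" "v (1 + k) \<in> \<int>"
    using m k by simp_all
  have Z1: "(?w \<otimes>\<^bsub>QQ.SG\<^esub> ?v) 0 \<in> \<int>" "(?w \<otimes>\<^bsub>QQ.SG\<^esub> ?v) 1 \<in> \<int>"
    unfolding QQ.mult_0[OF RS'] QQ.mult_1[OF RS'] using Z by simp_all
  have Z2: "(?w \<otimes>\<^bsub>QQ.SG\<^esub> ?v) i \<in> \<int>" if "i \<ge> 0" for i
    by (rule rec_Ints[OF QQ.mult_closed[OF RS'] Z1 that])
  have "?w \<otimes>\<^bsub>QQ.SG\<^esub> ?v = (\<lambda>n. (w \<otimes>\<^bsub>QQ.SG\<^esub> v) (n + (m + k)))"
    using QQ.mult_scale_shift_both[OF RS, of 1 1 m k] by simp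
  then have "(w \<otimes>\<^bsub>QQ.SG\<^esub> v) i \<in> \<int>" if "i \<ge> m + k" for i
    using Z2[of "i - (m + k)"] that by simp
  then show ?thesis
    unfolding L_iff using L_carrier[OF w] L_carrier[OF v] by blast
qed

text \<open>Only the product of classes is available here. Inverses divide by \<Lambda> and may
  leave L, so the quotient lemma for groups does not apply.\<close>

lemma LG_quot:
  shows LG_carrier: "carrier LG = lcls ` L"
    and LG_mult: "w \<in> L \<Longrightarrow> v \<in> L \<Longrightarrow> lcls w \<otimes>\<^bsub>LG\<^esub> lcls v = lcls (w \<otimes>\<^bsub>QQ.SG\<^esub> v)"
    and LG_one: "\<one>\<^bsub>LG\<^esub> = lcls \<one>\<^bsub>QQ.SG\<^esub>"
proof -
  show "carrier LG = lcls ` L" "\<one>\<^bsub>LG\<^esub> = lcls \<one>\<^bsub>QQ.SG\<^esub>"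
    by (auto simp: laxton_group_def quot_monoid_def quotient_def lcls_def)
  show "lcls w \<otimes>\<^bsub>LG\<^esub> lcls v = lcls (w \<otimes>\<^bsub>QQ.SG\<^esub> v)" if "w \<in> L" "v \<in> L"
    unfolding laxton_group_def lcls_def
    using quot_monoid_mult[of "QQ.SG\<lparr>carrier := L\<rparr>" "shift_rel rat_ring L" w v]
      QQ.shift_rel_equiv[OF L_RS] QQ.shift_rel_mult[OF L_RS L_mult] that by simp
qed

text \<open>Passing to L restricts the sequences but not the scalars and shifts that relate them.
  Injectivity of \<iota> rests on this.\<close>

lemma lcls_eq_iff:
  assumes "w \<in> L" "v \<in> L"
  shows "lcls w = lcls v \<longleftrightarrow> QQ.scls w = QQ.scls v"
proof -
  have "lcls w = lcls v \<longleftrightarrow> (w, v) \<in> shift_rel rat_ring L"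
    unfolding lcls_def by (rule eq_equiv_class_iff[OF QQ.shift_rel_equiv[OF L_RS] assms])
  also have "\<dots> \<longleftrightarrow> QQ.scls w = QQ.scls v"
    using QQ.scls_eq_iff[OF L_carrier L_carrier, OF assms] assms
    unfolding shift_rel_def fun_eq_iff by blast
  finally show ?thesis .
qed

lemma mem_lcls_iff: "w \<in> L \<Longrightarrow> v \<in> lcls w \<longleftrightarrow> v \<in> L \<and> QQ.scls v = QQ.scls w"
  using equiv_class_eq_iff[OF QQ.shift_rel_equiv[OF L_RS], of w v] lcls_eq_iff[of v w]
  unfolding lcls_def by auto

lemma to_GsQ_lcls: "w \<in> L \<Longrightarrow> to_GsQ P Q (lcls w) = QQ.scls w"
  using mem_lcls_iff by (intro to_GsQ_eq) auto

text \<open>Integral terms at 0 and 1 suffice for membership in L, so every rational class meets L;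
  this is the surjectivity of \<iota>.\<close>

lemma coprime_rep_L:
  assumes w: "w \<in> carrier QQ.SG"
  obtains v a b where "v \<in> L" "prim v" "QQ.scls v = QQ.scls w" "coprime_init v a b"
proof -
  obtain v a b where v: "v \<in> carrier QQ.SG" "QQ.cls v = QQ.cls w" "coprime_init v a b"
    using coprime_rep[OF w] .
  have "v 0 \<in> \<int>" "v 1 \<in> \<int>"
    using v(3) by (simp_all add: coprime_init_def)
  then have "v \<in> L"
    by (rule L_if_Ints[OF v(1)])
  then show ?thesis
    using that coprime_init_prim(1)[OF carrier_RS[OF v(1)] v(3)] cls_imp_scls[OF v(1) w v(2)] v(3)
        by blast
qed

lemma to_GsQ_bij: "bij_betw (to_GsQ P Q) (carrier LG) (carrier (GsQ P Q))"
proof (rule bij_betw_imageI)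
  show "inj_on (to_GsQ P Q) (carrier LG)"
    unfolding LG_carrier by (auto simp: inj_on_def to_GsQ_lcls lcls_eq_iff)
  show "to_GsQ P Q ` carrier LG = carrier (GsQ P Q)"
  proof (intro equalityI subsetI)
    fix C assume "C \<in> to_GsQ P Q ` carrier LG"
    then show "C \<in> carrier (GsQ P Q)"
      unfolding LG_carrier QQ.Gs_quot(3) by (auto simp: to_GsQ_lcls L_carrier)
  next
    fix C assume "C \<in> carrier (GsQ P Q)"
    then obtain w where w: "w \<in> carrier QQ.SG" "C = QQ.scls w"
      unfolding QQ.Gs_quot(3) by blast
    obtain v a b where v: "v \<in> L" "prim v" "QQ.scls v = QQ.scls w" "coprime_init v a b"
      using coprime_rep_L[OF w(1)] .
    have "C = to_GsQ P Q (lcls v)"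
      using w(2) v(3) to_GsQ_lcls[OF v(1)] by simp
    then show "C \<in> to_GsQ P Q ` carrier LG"
      unfolding LG_carrier using imageI[OF v(1)] by (rule image_eqI)
  qed
qed

lemma to_GsQ_iso: "to_GsQ P Q \<in> iso LG (GsQ P Q)"
proof (rule isoI)
  show "to_GsQ P Q \<in> hom LG (GsQ P Q)"
  proof (rule homI)
    fix A B assume "A \<in> carrier LG" "B \<in> carrier LG"
    then obtain w v where w: "w \<in> L" "A = lcls w" and v: "v \<in> L" "B = lcls v"
      unfolding LG_carrier by blast
    then show "to_GsQ P Q A \<in> carrier (GsQ P Q)"
      by (simp add: to_GsQ_lcls L_carrier)
    show "to_GsQ P Q (A \<otimes>\<^bsub>LG\<^esub> B) = to_GsQ P Q A \<otimes>\<^bsub>GsQ P Q\<^esub> to_GsQ P Q B"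
      using w v L_mult[of w v] by (simp add: LG_mult to_GsQ_lcls L_carrier)
  qed
qed (rule to_GsQ_bij)

lemma one_L: "\<one>\<^bsub>QQ.SG\<^esub> \<in> L"
  using QQ.one_rec(2,3) by (intro L_if_Ints) simp_all

text \<open>The inverse of \<iota> is a homomorphism from the group \<open>GsQ P Q\<close> onto
  Laxton's quotient, which is thus a group as a homomorphic image. Its unit is the intended one
  because \<iota> sends the class of the Lucas sequence to the unit.\<close>

lemma LG_comm_group: "comm_group LG"
proof -
  interpret Gs: comm_group "GsQ P Q" by (rule QQ.Gs_quot)
  let ?f = "to_GsQ P Q" and ?g = "inv_into (carrier LG) (to_GsQ P Q)"
  have inj: "inj_on ?f (carrier LG)" and surj: "?f ` carrier LG = carrier (GsQ P Q)"
    using to_GsQ_bij by (simp_all add: bij_betw_def)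
  have gf: "?g (?f A) = A" if "A \<in> carrier LG" for A
    using inj that by (rule inv_into_f_f)
  have closed: "A \<otimes>\<^bsub>LG\<^esub> B \<in> carrier LG" if "A \<in> carrier LG" "B \<in> carrier LG" for A B
    using that unfolding LG_carrier by (auto simp: LG_mult L_mult)
  have hom_f: "?f (A \<otimes>\<^bsub>LG\<^esub> B) = ?f A \<otimes>\<^bsub>GsQ P Q\<^esub> ?f B" if "A \<in> carrier LG" "B \<in> carrier LG" for A B
    using to_GsQ_iso that by (simp add: iso_def hom_def)
  have "?g \<in> hom (GsQ P Q) LG"
  proof (rule homI)
    fix C D assume "C \<in> carrier (GsQ P Q)" "D \<in> carrier (GsQ P Q)"
    then obtain A B where A: "A \<in> carrier LG" "C = ?f A" and B: "B \<in> carrier LG" "D = ?f B"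
      unfolding surj[symmetric] by blast
    then show "?g C \<in> carrier LG"
      by (simp add: gf)
    show "?g (C \<otimes>\<^bsub>GsQ P Q\<^esub> D) = ?g C \<otimes>\<^bsub>LG\<^esub> ?g D"
      using A B gf[OF closed[OF A(1) B(1)]] by (simp add: gf hom_f)
  qed
  from scls.H.hom_imp_img_group[OF this]
  have "group (LG\<lparr>carrier := ?g ` carrier (GsQ P Q), one := ?g \<one>\<^bsub>GsQ P Q\<^esub>\<rparr>)" .
  moreover have "?g ` carrier (GsQ P Q) = carrier LG"
    using gf unfolding surj[symmetric] image_image by simp
  moreover have "?g \<one>\<^bsub>GsQ P Q\<^esub> = \<one>\<^bsub>LG\<^esub>"
  proof -
    have "\<one>\<^bsub>LG\<^esub> \<in> carrier LG"
      unfolding LG_carrier LG_one using one_L by (rule imageI)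
    moreover have "?f \<one>\<^bsub>LG\<^esub> = \<one>\<^bsub>GsQ P Q\<^esub>"
      unfolding LG_one to_GsQ_lcls[OF one_L] by simp
    ultimately show ?thesis
      using gf by metis
  qed
  ultimately have "group LG" by simp
  then interpret LG: group LG .
  show ?thesis
  proof (rule LG.group_comm_groupI)
    fix A B assume AB: "A \<in> carrier LG" "B \<in> carrier LG"
    then have "?f A \<in> carrier (GsQ P Q)" "?f B \<in> carrier (GsQ P Q)"
      unfolding surj[symmetric] by blast+
    then have "?f (A \<otimes>\<^bsub>LG\<^esub> B) = ?f (B \<otimes>\<^bsub>LG\<^esub> A)"
      using AB by (simp add: hom_f Gs.m_comm)
    then show "A \<otimes>\<^bsub>LG\<^esub> B = B \<otimes>\<^bsub>LG\<^esub> A"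
      using inj closed AB by (meson inj_onD)
  qed
qed

section \<open>Laxton's subgroups\<close>

lemma Ints_Zp: "x \<in> \<int> \<Longrightarrow> x \<in> Zp"
  by (auto elim: Ints_cases)

text \<open>In one direction, a coprime member has a term divisible by p; shifted to index 0, it
  makes \<Lambda> congruent to the square of the next term, which is prime to p. Conversely, each
  member is c times a shift of s, and eventual integrality puts c into Z_(p), so the term of s
  divisible by p stays divisible.\<close>

lemma laxton_G_image: "to_GsQ P Q ` laxton_G P Q p = QQ.scls ` local_kernel"
proof (intro equalityI subsetI)
  fix C assume "C \<in> to_GsQ P Q ` laxton_G P Q p"
  then obtain u where u: "u \<in> L" "C = QQ.scls u" "\<And>w. w \<in> lcls u \<Longrightarrow> seq_dvd p w"
    unfolding laxton_G_def LG_carrier by (auto simp: to_GsQ_lcls)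
  obtain v a b where v: "v \<in> L" "prim v" "QQ.scls v = QQ.scls u" "coprime_init v a b"
    using coprime_rep_L[OF L_carrier[OF u(1)]] .
  then have "seq_dvd p v"
    using u(3) mem_lcls_iff[OF u(1)] by blast
  then obtain m where m: "v m \<in> I"
    unfolding seq_dvd_def by blast
  have m1: "v (m + 1) \<notin> I"
    by (rule prim_consecutive[OF v(2) m])
  note Z = local_seqs_Zp[OF prim_local_seqs[OF v(2)]]
  let ?w = "\<lambda>n. 1 * v (n + m)"
  have wl: "?w \<in> local_seqs"
    by (rule local_seqs_scale_shift[OF prim_local_seqs[OF v(2)]]) simp
  have wc: "?w \<in> carrier QQ.SG"
    by (rule QQ_carrier_scale_shift[OF L_carrier[OF v(1)]]) simp
  have "QQ.Nm (?w 1) (?w 0) \<notin> I"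
  proof
    assume "QQ.Nm (?w 1) (?w 0) \<in> I"
    then have *: "v (m + 1) * v (m + 1) - of_int P * v m * v (m + 1) + of_int Q * (v m * v m) \<in> I"
      by (simp add: QQ.Lam_eq add.commute)
    \<comment> \<open>All summands of \<Lambda> other than the leading square contain the factor
      \<open>v m\<close>.\<close>
    have "of_int Q * (v m * v m) - of_int P * v m * v (m + 1) \<in> I"
      using Z m by (simp add: I_mult)
    from I_diff[OF * this] have "v (m + 1) * v (m + 1) \<in> I"
      by simp
    then show False
      using m1 Z by (simp add: I_mult_iff)
  qed
  then have "?w \<in> local_kernel"
    using wl wc m red_seq_carrier_iff[OF wl] by (simp add: local_kernel_def local_units_def)
  moreover have "QQ.scls ?w = QQ.scls v"
    using QQ_scls_eq_iff[OF wc L_carrier[OF v(1)]] by (metis zero_neq_one)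
  ultimately show "C \<in> QQ.scls ` local_kernel"
    using u(2) v(3) by (metis imageI)
next
  fix C assume "C \<in> QQ.scls ` local_kernel"
  then obtain s where s: "s \<in> local_kernel" "C = QQ.scls s" by blast
  then have sS: "s \<in> local_units" and s0: "s 0 \<in> I"
    by (simp_all add: local_kernel_def)
  obtain w a b where w: "w \<in> L" "prim w" "QQ.scls w = QQ.scls s" "coprime_init w a b"
    using coprime_rep_L[OF local_units_carrier[OF sS]] .
  have "seq_dvd p v" if v: "v \<in> lcls w" for v
  proof -
    have vL: "v \<in> L" "QQ.scls v = QQ.scls s"
      using v mem_lcls_iff[OF w(1)] w(3) by auto
    then obtain c m where c: "v = (\<lambda>n. c * s (n + m))"
      using QQ_scls_eq_iff[OF L_carrier[OF vL(1)] local_units_carrier[OF sS]] by blast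
    obtain k where "\<And>n. n \<ge> k \<Longrightarrow> v n \<in> Zp"
      using vL(1) Ints_Zp unfolding L_iff by blast
    then have "c \<in> Zp"
      by (rule ratio_Zp[OF local_units_prim[OF sS] _ c])
    then have "v (- m) \<in> I"
      unfolding c using s0 by (simp add: I_mult)
    then show ?thesis
      unfolding seq_dvd_def by blast
  qed
  then have "lcls w \<in> laxton_G P Q p"
    using w(1) by (simp add: laxton_G_def LG_carrier)
  then show "C \<in> to_GsQ P Q ` laxton_G P Q p"
    using to_GsQ_lcls[OF w(1)] w(3) s(2) by (metis imageI)
qed

lemma Nm_of_int: "QQ.Nm (of_int a) (of_int b) = of_int (a^2 - P * b * a + Q * b^2)"
  by (simp add: rat_ring_Lam)

text \<open>A coprime integral member is primitive, so it lies in \<open>local_units\<close> as soon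
  as its class meets \<open>local_units\<close>; the norm condition can then be tested on
  it.\<close>

lemma laxton_K_image: "to_GsQ P Q ` laxton_K P Q p = QQ.scls ` local_units"
proof (intro equalityI subsetI)
  fix C assume "C \<in> to_GsQ P Q ` laxton_K P Q p"
  then obtain u w a b where u: "u \<in> L" "C = QQ.scls u" and w: "w \<in> lcls u" "w 1 = of_int a" "w 0
      = of_int b"
      "\<not> int p dvd (a^2 - P * b * a + Q * b^2)"
    unfolding laxton_K_def LG_carrier by (auto simp: to_GsQ_lcls)
  have wL: "w \<in> L" "QQ.scls w = QQ.scls u"
    using w(1) mem_lcls_iff[OF u(1)] by auto
  have wl: "w \<in> local_seqs"
    using subsetD[OF L_RS wL(1)] w by (simp add: local_seqs_def)
  have "QQ.Nm (w 1) (w 0) \<notin> I"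
    unfolding w(2,3) Nm_of_int I_of_int by (rule w(4))
  then have "w \<in> local_units"
    using wl L_carrier[OF wL(1)] red_seq_carrier_iff[OF wl] by (simp add: local_units_def)
  then show "C \<in> QQ.scls ` local_units"
    using u(2) wL(2) by (metis imageI)
next
  fix C assume "C \<in> QQ.scls ` local_units"
  then obtain s where s: "s \<in> local_units" "C = QQ.scls s" by blast
  obtain w a b where w: "w \<in> L" "prim w" "QQ.scls w = QQ.scls s" "coprime_init w a b"
    using coprime_rep_L[OF local_units_carrier[OF s(1)]] .
  have wS: "w \<in> local_units"
    by (rule local_units_transfer[OF s(1) w(2) L_carrier[OF w(1)] w(3)])
  have ab: "w 1 = of_int a" "w 0 = of_int b"
    using w(4) by (simp_all add: coprime_init_def)
  have "\<not> int p dvd (a^2 - P * b * a + Q * b^2)"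
    using red_seq_carrier_iff[OF local_units_local_seqs[OF wS]] local_units_rds[OF wS]
        unfolding ab Nm_of_int I_of_int by simp
  then have "lcls w \<in> laxton_K P Q p"
    using w(1) ab mem_lcls_iff[OF w(1)] unfolding laxton_K_def LG_carrier by blast
  then show "C \<in> to_GsQ P Q ` laxton_K P Q p"
    using to_GsQ_lcls[OF w(1)] w(3) s(2) by (metis imageI)
qed

lemma laxton_H_eq: "laxton_H P Q p = radical LG (laxton_G P Q p)"
  by (simp add: laxton_H_def radical_def)

text \<open>A condition on all members of a class does not visibly survive products; closure is
  inherited from the image under \<iota>.\<close>

lemma laxton_G_subgroup: "subgroup (laxton_G P Q p) LG"
  using Gs_p_subgroup unfolding Gs_p_eq laxton_G_image[symmetric]
  by (rule subgroup_iso_vimage[OF comm_group.axioms(2)[OF LG_comm_group] scls.H.group_axioms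
      to_GsQ_iso, rotated])
    (auto simp: laxton_G_def)

lemma laxton_K_subgroup: "subgroup (laxton_K P Q p) LG"
  using Ks_p_subgroup unfolding Ks_p_eq laxton_K_image[symmetric]
  by (rule subgroup_iso_vimage[OF comm_group.axioms(2)[OF LG_comm_group] scls.H.group_axioms
      to_GsQ_iso, rotated])
    (auto simp: laxton_K_def)

lemma laxton_H_subgroup: "subgroup (laxton_H P Q p) LG"
  unfolding laxton_H_eq by (rule comm_group.radical_subgroup[OF LG_comm_group laxton_G_subgroup])

text \<open>Both sides are radicals of corresponding subgroups, and the kernel condition of
  \<open>radical_image\<close> is immediate because \<iota> is injective.\<close>

lemma laxton_H_image: "to_GsQ P Q ` laxton_H P Q p = Hs_p P Q p"
proof -
  interpret LG: comm_group LG by (rule LG_comm_group)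
  interpret h: group_hom LG "GsQ P Q" "to_GsQ P Q"
    using to_GsQ_iso by unfold_locales (simp add: iso_def)
  have "kernel LG (GsQ P Q) (to_GsQ P Q) = {\<one>\<^bsub>LG\<^esub>}"
    using to_GsQ_bij h.inj_iff_trivial_ker by (simp add: bij_betw_def)
  then have "kernel LG (GsQ P Q) (to_GsQ P Q) \<subseteq> radical LG (laxton_G P Q p)"
    using subgroup.one_closed[OF LG.radical_subgroup[OF laxton_G_subgroup]] by simp
  moreover have "to_GsQ P Q ` carrier LG = carrier (GsQ P Q)"
    using to_GsQ_bij by (simp add: bij_betw_def)
  ultimately show ?thesis
    unfolding laxton_H_eq Hs_p_eq Gs_p_eq laxton_G_image[symmetric]
    by (intro radical_image h.group_hom_axioms LG_comm_group laxton_G_subgroup)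
qed

section \<open>The reduction homomorphism and its kernel\<close>

lemma Gs_class_rds:
  assumes s: "s \<in> local_units" and w: "w \<in> QQ.scls s" "coprime_init w a b"
  shows "Gs_class Fp (P mod int p) (Q mod int p) (a mod int p) (b mod int p) = FF.scls (red_seq s)"
proof -
  have wc: "w \<in> carrier QQ.SG" "QQ.scls w = QQ.scls s"
    using w(1) QQ.mem_scls_iff[OF local_units_carrier[OF s]] by auto
  note cop = coprime_init_prim[OF carrier_RS[OF wc(1)] w(2)]
  have "init_seq Fp (P mod int p) (Q mod int p) (a mod int p) (b mod int p) = red_seq w"
    using red_seq_RS[OF prim_local_seqs[OF cop(1)]] cop(2,3) by (rule FF.init_seq_eqI)
  then show ?thesis
    using local_units_transfer(2)[OF s cop(1) wc] unfolding Gs_class_def FF.scls_def by simp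
qed

lemma coprime_mem_scls:
  assumes "s \<in> carrier QQ.SG"
  shows "\<exists>w\<in>QQ.scls s. \<exists>a b. coprime_init w a b"
proof -
  obtain w a b where "w \<in> L" "prim w" "QQ.scls w = QQ.scls s" "coprime_init w a b"
    using coprime_rep_L[OF assms] .
  then show ?thesis
    using QQ.mem_scls_iff[OF assms] L_carrier by blast
qed

text \<open>Reduction may be computed from any representative in \<open>local_units\<close>.
  Multiplicativity depends on this freedom, since a product of coprime representatives need not be
  coprime.\<close>

lemma red_Gs_scls:
  assumes s: "s \<in> local_units"
  shows "red_Gs P Q p (QQ.scls s) = FF.scls (red_seq s)"
  unfolding red_Gs_def
  using coprime_mem_scls[OF local_units_carrier[OF s]] Gs_class_rds[OF s]
      by (intro the_equality) metis+

text \<open>Residues at 1 and 0 lift to integers. The norm of the lift is prime to p, in particular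
  nonzero, so the lift lies in the rational group.\<close>

lemma red_seq_surj: "red_seq ` local_units = carrier FF.SG"
proof (intro equalityI subsetI)
  fix u assume u: "u \<in> carrier FF.SG"
  then have uR: "u \<in> FF.RS"
    using FF.carrier_sub_RS by blast
  have mod: "u n mod int p = u n" for n
    using FF.rec_closed[OF uR, of n] by (simp add: F.res_carrier_eq)
  define w where "w = init_seq rat_ring (of_int P) (of_int Q) (of_int (u 1)) (of_int (u 0))"
  have w: "w \<in> QQ.RS" "w 1 = of_int (u 1)" "w 0 = of_int (u 0)"
    unfolding w_def by (rule QQ.init_seq; simp)+
  have wl: "w \<in> local_seqs"
    using w by (simp add: local_seqs_def)
  have eq: "red_seq w = u"
    by (rule FF.rec_seqs_eqI[OF red_seq_RS[OF wl] uR]) (simp_all add: red_seq_def w rd_of_int mod)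
  then have "QQ.Nm (w 1) (w 0) \<notin> I"
    using u red_seq_carrier_iff[OF wl] by simp
  then have "w \<in> carrier QQ.SG"
    using w(1) I_0 unfolding QQ.carrier_seq_group rat_ring_Units by auto
  then have "w \<in> local_units"
    using wl eq u by (simp add: local_units_def)
  then show "u \<in> red_seq ` local_units"
    using eq by blast
qed (auto simp: local_units_rds)

sublocale sclsF: group_hom FF.SG "GsF P Q p" FF.scls
  by (rule FF.Gs_quot)

lemma red_Gs_hom: "group_hom (GsQ P Q\<lparr>carrier := Ks_p P Q p\<rparr>) (GsF P Q p) (red_Gs P Q p)"
proof -
  have "red_Gs P Q p \<in> hom (GsQ P Q\<lparr>carrier := Ks_p P Q p\<rparr>) (GsF P Q p)"
  proof (rule homI)
    fix A B assume "A \<in> carrier (GsQ P Q\<lparr>carrier := Ks_p P Q p\<rparr>)" "B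
        \<in> carrier (GsQ P Q\<lparr>carrier := Ks_p P Q p\<rparr>)"
    then obtain s t where s: "s \<in> local_units" "A = QQ.scls s" and t: "t \<in> local_units" "B
        = QQ.scls t"
      unfolding Ks_p_eq by auto
    show "red_Gs P Q p A \<in> carrier (GsF P Q p)"
      unfolding s(2) red_Gs_scls[OF s(1)] by (rule sclsF.hom_closed[OF local_units_rds[OF s(1)]])
    have "A \<otimes>\<^bsub>GsQ P Q\<^esub> B = QQ.scls (s \<otimes>\<^bsub>QQ.SG\<^esub> t)"
      using s t local_units_carrier by simp
    then have "red_Gs P Q p (A \<otimes>\<^bsub>GsQ P Q\<^esub> B) = FF.scls (red_seq s \<otimes>\<^bsub>FF.SG\<^esub> red_seq t)"
      using red_Gs_scls[OF subgroup.m_closed[OF local_units_subgroup s(1) t(1)]]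
          red_seq_mult[OF local_units_local_seqs local_units_local_seqs, OF s(1) t(1)]
      by simp
    also have "\<dots> = red_Gs P Q p A \<otimes>\<^bsub>GsF P Q p\<^esub> red_Gs P Q p B"
      using local_units_rds[OF s(1)] local_units_rds[OF t(1)] by (simp add: s t red_Gs_scls)
    finally show "red_Gs P Q p (A \<otimes>\<^bsub>GsQ P Q\<lparr>carrier := Ks_p P Q p\<rparr>\<^esub> B) =
        red_Gs P Q p A \<otimes>\<^bsub>GsF P Q p\<^esub> red_Gs P Q p B"
      by simp
  qed
  then show ?thesis
    by (intro group_hom.intro group_hom_axioms.intro sclsF.H.group_axioms
        subgroup.subgroup_is_group[OF Ks_p_subgroup scls.H.group_axioms])
qed

lemma local_kernel_sub_local_units: "local_kernel \<subseteq> local_units"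
  by (auto simp: local_kernel_def)

text \<open>Trivial reduction means being a multiple of the Lucas sequence shifted by m, which
  vanishes at -m; shifting s by -m brings this zero to index 0. Conversely, if p divides the term at
  0, the reduction is a multiple of the Lucas sequence.\<close>

lemma red_Gs_eq_one_iff:
  assumes s: "s \<in> local_units"
  shows "red_Gs P Q p (QQ.scls s) = \<one>\<^bsub>GsF P Q p\<^esub> \<longleftrightarrow> QQ.scls s \<in> Gs_p P Q p"
proof
  assume "red_Gs P Q p (QQ.scls s) = \<one>\<^bsub>GsF P Q p\<^esub>"
  then have "FF.scls (red_seq s) = FF.scls \<one>\<^bsub>FF.SG\<^esub>"
    using red_Gs_scls[OF s] by simp
  then obtain c m where c: "c \<in> Units Fp" "red_seq s = (\<lambda>n. c \<otimes>\<^bsub>Fp\<^esub> \<one>\<^bsub>FF.SG\<^esub> (n + m))"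
    using FF.scls_eq_iff[OF local_units_rds[OF s] FF.SG.one_closed] by blast
  let ?t = "\<lambda>n. 1 * s (n + - m)"
  have t: "?t \<in> local_units"
    by (rule local_units_scale_shift[OF s]) simp_all
  have "red_seq s (- m) = c \<otimes>\<^bsub>Fp\<^esub> \<zero>\<^bsub>Fp\<^esub>"
    unfolding c(2) by (simp only: ab_left_minus FF.one_rec)
  then have "rd (s (- m)) = 0"
    using F.Units_closed[OF c(1)] by (simp add: red_seq_def F.res_zero_eq[symmetric])
  then have "s (- m) \<in> I"
    using rd_eq_0_iff[OF local_seqs_Zp[OF local_units_local_seqs[OF s]]] by simp
  then have "?t \<in> local_kernel"
    using t by (simp add: local_kernel_def)
  moreover have "QQ.scls ?t = QQ.scls s"
    using QQ_scls_eq_iff[OF local_units_carrier[OF t] local_units_carrier[OF s]]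
        by (metis zero_neq_one)
  ultimately show "QQ.scls s \<in> Gs_p P Q p"
    unfolding Gs_p_eq by (metis imageI)
next
  assume "QQ.scls s \<in> Gs_p P Q p"
  then obtain t where t: "t \<in> local_kernel" "QQ.scls s = QQ.scls t"
    unfolding Gs_p_eq by blast
  then have tS: "t \<in> local_units" and t0: "t 0 \<in> I"
    by (simp_all add: local_kernel_def)
  note Z = local_seqs_Zp[OF local_units_local_seqs[OF tS]]
  have u: "rd (t 1) \<in> Units Fp"
    using local_units_prim[OF tS] t0 rd_Units_iff[OF Z] by (simp add: prim_def)
  let ?v = "\<lambda>n. rd (t 1) \<otimes>\<^bsub>Fp\<^esub> \<one>\<^bsub>FF.SG\<^esub> (n + 0)"
  have v: "?v \<in> carrier FF.SG"
    by (rule FF.carrier_scale_shift[OF FF.SG.one_closed u])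
  have "red_seq t = ?v"
  proof (rule FF.rec_seqs_eqI[OF
      red_seq_RS[OF local_units_local_seqs[OF tS]] subsetD[OF FF.carrier_sub_RS v]])
    show "red_seq t 1 = rd (t 1) \<otimes>\<^bsub>Fp\<^esub> \<one>\<^bsub>FF.SG\<^esub> (1 + 0)"
      unfolding add_0_right FF.one_rec F.r_one[OF F.Units_closed[OF u]] by (simp add: red_seq_def)
    show "red_seq t 0 = rd (t 1) \<otimes>\<^bsub>Fp\<^esub> \<one>\<^bsub>FF.SG\<^esub> (0 + 0)"
      unfolding add_0_right FF.one_rec F.r_null[OF F.Units_closed[OF u]]
      using rd_eq_0_iff[OF Z] t0 by (simp add: red_seq_def F.res_zero_eq)
  qed
  then have "FF.scls (red_seq t) = FF.scls \<one>\<^bsub>FF.SG\<^esub>"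
    using FF.scls_eq_iff[OF local_units_rds[OF tS] FF.SG.one_closed] u by blast
  then show "red_Gs P Q p (QQ.scls s) = \<one>\<^bsub>GsF P Q p\<^esub>"
    unfolding t(2) red_Gs_scls[OF tS] by simp
qed

lemma reduction_exact:
  "short_exact (GsQ P Q\<lparr>carrier := Gs_p P Q p\<rparr>) (\<lambda>W. W)
    (GsQ P Q\<lparr>carrier := Ks_p P Q p\<rparr>) (red_Gs P Q p) (GsF P Q p)"
  unfolding short_exact_def
proof (intro conjI red_Gs_hom)
  have sub: "Gs_p P Q p \<subseteq> Ks_p P Q p"
    unfolding Gs_p_eq Ks_p_eq using local_kernel_sub_local_units by (rule image_mono)
  show "group_hom (GsQ P Q\<lparr>carrier := Gs_p P Q p\<rparr>) (GsQ P Q\<lparr>carrier := Ks_p P Q p\<rparr>) (\<lambda>W. W)"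
    using sub
    by (intro group_hom.intro group_hom_axioms.intro homI
        subgroup.subgroup_is_group[OF Ks_p_subgroup scls.H.group_axioms]
        subgroup.subgroup_is_group[OF Gs_p_subgroup scls.H.group_axioms]) auto
  show "inj_on (\<lambda>W. W) (carrier (GsQ P Q\<lparr>carrier := Gs_p P Q p\<rparr>))"
    by (simp add: inj_on_def)
  have "W \<in> Gs_p P Q p \<longleftrightarrow> red_Gs P Q p W = \<one>\<^bsub>GsF P Q p\<^esub>" if "W \<in> Ks_p P Q p" for W
    using that red_Gs_eq_one_iff unfolding Ks_p_eq by blast
  then show "(\<lambda>W. W) ` carrier (GsQ P Q\<lparr>carrier := Gs_p P Q p\<rparr>) =
      kernel (GsQ P Q\<lparr>carrier := Ks_p P Q p\<rparr>) (GsF P Q p) (red_Gs P Q p)"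
    using sub by (auto simp: kernel_def)
  have "red_Gs P Q p ` Ks_p P Q p = FF.scls ` red_seq ` local_units"
    unfolding Ks_p_eq image_image by (rule image_cong[OF refl red_Gs_scls])
  then show "red_Gs P Q p ` carrier (GsQ P Q\<lparr>carrier := Ks_p P Q p\<rparr>) = carrier (GsF P Q p)"
    unfolding FF.Gs_quot(3) red_seq_surj by simp
qed

end

theorem theorem7:
  fixes P Q :: int and p :: nat
  assumes "Q \<noteq> 0" and "P^2 - 4 * Q \<noteq> 0"
    and "prime p" and "\<not> int p dvd Q"
  shows "(group (laxton_group P Q) \<and> group (GsQ P Q) \<and>
      to_GsQ P Q \<in> iso (laxton_group P Q) (GsQ P Q)) \<and>
    (subgroup (laxton_G P Q p) (laxton_group P Q) \<and>
      subgroup (laxton_K P Q p) (laxton_group P Q) \<and>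
      subgroup (laxton_H P Q p) (laxton_group P Q)) \<and>
    (subgroup (Gs_p P Q p) (GsQ P Q) \<and>
      subgroup (Ks_p P Q p) (GsQ P Q) \<and>
      subgroup (Hs_p P Q p) (GsQ P Q)) \<and>
    (to_GsQ P Q ` laxton_G P Q p = Gs_p P Q p) \<and>
    (to_GsQ P Q ` laxton_K P Q p = Ks_p P Q p) \<and>
    (to_GsQ P Q ` laxton_H P Q p = Hs_p P Q p) \<and>
    (\<forall>W \<in> Ks_p P Q p.
      (\<exists>w\<in>W. \<exists>a b. coprime_init w a b) \<and>
      (\<forall>w\<in>W. \<forall>a b. coprime_init w a b \<longrightarrow>
        red_Gs P Q p W =
          Gs_class (residue_ring (int p)) (P mod int p) (Q mod int p) (a mod int p) (b mod int p))) \<and>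
    (short_exact (GsQ P Q\<lparr>carrier := Gs_p P Q p\<rparr>) (\<lambda>W. W)
      (GsQ P Q\<lparr>carrier := Ks_p P Q p\<rparr>) (red_Gs P Q p) (GsF P Q p))"
proof -
  interpret laxton p P Q
    using assms by unfold_locales
  have "\<forall>W \<in> Ks_p P Q p.
      (\<exists>w\<in>W. \<exists>a b. coprime_init w a b) \<and>
      (\<forall>w\<in>W. \<forall>a b. coprime_init w a b \<longrightarrow>
        red_Gs P Q p W =
          Gs_class (residue_ring (int p)) (P mod int p) (Q mod int p) (a mod int p) (b mod int p))"
  proof
    fix W assume "W \<in> Ks_p P Q p"
    then obtain s where s: "s \<in> local_units" "W = QQ.scls s"
      unfolding Ks_p_eq by blast
    then show "(\<exists>w\<in>W. \<exists>a b. coprime_init w a b) \<and>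
      (\<forall>w\<in>W. \<forall>a b. coprime_init w a b \<longrightarrow>
        red_Gs P Q p W =
          Gs_class (residue_ring (int p)) (P mod int p) (Q mod int p) (a mod int p) (b mod int p))"
      using coprime_mem_scls[OF local_units_carrier[OF s(1)]] Gs_class_rds[OF s(1)] red_Gs_scls[OF s(1)] by simp
  qed
  moreover have "group (laxton_group P Q)"
    by (rule comm_group.axioms(2)[OF LG_comm_group])
  ultimately show ?thesis
    using scls.H.group_axioms to_GsQ_iso laxton_G_subgroup laxton_K_subgroup laxton_H_subgroup
      Gs_p_subgroup Ks_p_subgroup Hs_p_subgroup laxton_G_image laxton_K_image laxton_H_image
      Gs_p_eq Ks_p_eq reduction_exact
    by simp
qed

end
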